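(* Let $p$ be a prime, $t\in\mathbb{N}$, $b_1(X),\ldots,b_t(X)\in\mathbb{F}_p[X]$ monic, nonconstant, pairwise coprime, and let $(\boldsymbol y_n)_{n\ge0}$ be the Halton sequence in these bases. For $L\in\mathcal H$ let $(x_n)_{n\ge0}$ be the digital Kronecker sequence associated with $L$. Then for $h$-almost all $L\in\mathcal H$ the following holds: for every $\epsilon>0$ there is a constant $c=c(p,L,b_1,\ldots,b_t,\epsilon)>0$ such that the star discrepancy of $((x_n,\boldsymbol y_n))_{n\ge0}$ satisfies $ND_N^*\le c\log^{t+1+\epsilon}N$ for all $N\ge2$.
   Context: $\mathcal H$ is the set of $L\in\mathbb{F}_p((X^{-1}))$ with $\nu(L)<0$, where for $L=\sum_{i=w}^\infty a_iX^{-i}$ with $a_w\ne0$, $\nu(L)=-w$ (and $\nu(0)=-\infty$); $h$ is the normalized Haar measure on (the additive compact group) $\mathcal H$. Elements of $\mathbb{F}_p$ are identified with $\{0,\ldots,p-1\}$. For $n=n_0+n_1p+\cdots$ in base $p$, $n(X)=n_0+n_1X+\cdots$. $\{L\}=\sum_{i\ge\max(1,w)}a_iX^{-i}$. Digital Kronecker sequence for $L$: writing $\{n(X)L\}=\sum_{i\ge1}c_iX^{-i}$, $x_n=\sum_{i\ge1}c_ip^{-i}$. Van der Corput sequence in base $b(X)$ (monic, nonconstant, degree $e$): $n(X)=\sum_{i\ge0}a_i(X)b(X)^i$ with $\deg a_i<e$, $y_n=\sum_{i\ge0}a_i(p)p^{-e(i+1)}$; the Halton sequence juxtaposes coordinatewise.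 Star discrepancy: $D_N^*=\sup_B|A_N(B)/N-\lambda(B)|$ over boxes $B=\prod[0,\beta_i)\subseteq[0,1)^{1+t}$, $A_N(B)=\#\{0\le n<N:(x_n,\boldsymbol y_n)\in B\}$. *)

theory Defs
  imports "HOL-Probability.Probability" "HOL-Computational_Algebra.Polynomial"
    "Berlekamp_Zassenhaus.Finite_Field"
begin

text \<open>The prime p is CARD('p) for a type 'p of class prime_card; F_p = 'p mod_ring,
  whose elements are identified with 0..p-1 via to_int_mod_ring.\<close>

definition nat_poly :: "nat \<Rightarrow> 'p::prime_card mod_ring poly" where
  "nat_poly n = (\<Sum>k<Suc n. Polynomial.monom (of_nat ((n div CARD('p) ^ k) mod CARD('p))) k)"

text \<open>An element L of H = { L : nu(L) < 0 } is L = sum_{i>=1} a_i X^(-i); we store it as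
  the coefficient sequence a with  a j = a_(j+1).\<close>

definition haar_H :: "(nat \<Rightarrow> 'p::prime_card mod_ring) measure" where
  "haar_H = PiM UNIV (\<lambda>_. uniform_count_measure (UNIV :: 'p mod_ring set))"

text \<open>Coefficient c_(k+1) of X^(-(k+1)) in {n(X) L}.\<close>
definition kron_digit :: "(nat \<Rightarrow> 'p::prime_card mod_ring) \<Rightarrow> nat \<Rightarrow> nat \<Rightarrow> 'p mod_ring" where
  "kron_digit a n k = (\<Sum>j\<le>degree (nat_poly n :: 'p mod_ring poly). Polynomial.coeff (nat_poly n) j * a (k + j))"

definition kronecker :: "(nat \<Rightarrow> 'p::prime_card mod_ring) \<Rightarrow> nat \<Rightarrow> real" where
  "kronecker a n = (\<Sum>k. real_of_int (to_int_mod_ring (kron_digit a n k)) / real CARD('p) ^ Suc k)"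

definition eval_at_p :: "'p::prime_card mod_ring poly \<Rightarrow> real" where
  "eval_at_p q = (\<Sum>k\<le>degree q. real_of_int (to_int_mod_ring (Polynomial.coeff q k)) * real CARD('p) ^ k)"

text \<open>Van der Corput sequence in base b(X) (degree e): n(X) = sum_i a_i(X) b(X)^i with
  deg a_i < e, i.e. a_i = (n(X) div b^i) mod b; y_n = sum_i a_i(p) p^(-e(i+1)).
  The a_i vanish for i > degree n(X), so the sum is finite.\<close>
definition vdc_poly :: "'p::prime_card mod_ring poly \<Rightarrow> nat \<Rightarrow> real" where
  "vdc_poly b n = (\<Sum>i\<le>degree (nat_poly n :: 'p mod_ring poly).
      eval_at_p ((nat_poly n div b ^ i) mod b) / real CARD('p) ^ (degree b * (i + 1)))"

definition hybrid_point :: "(nat \<Rightarrow> 'p::prime_card mod_ring) \<Rightarrow> 'p mod_ring poly list \<Rightarrow> nat \<Rightarrow> nat \<Rightarrow> real" where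
  "hybrid_point a bs n i = (if i = 0 then kronecker a n else vdc_poly (bs ! (i - 1)) n)"

definition count_box :: "(nat \<Rightarrow> nat \<Rightarrow> real) \<Rightarrow> nat \<Rightarrow> nat \<Rightarrow> (nat \<Rightarrow> real) \<Rightarrow> nat" where
  "count_box P d N \<beta> = card {n. n < N \<and> (\<forall>i<d. P n i < \<beta> i)}"

definition star_discrepancy :: "(nat \<Rightarrow> nat \<Rightarrow> real) \<Rightarrow> nat \<Rightarrow> nat \<Rightarrow> real" where
  "star_discrepancy P d N = (SUP \<beta> \<in> {\<beta>. \<forall>i<d. 0 \<le> \<beta> i \<and> \<beta> i \<le> 1}.
      \<bar>real (count_box P d N \<beta>) / real N - (\<Prod>i<d. \<beta> i)\<bar>)"

end

theory Submission
  imports Defs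
begin

text \<open>
  The condition that the Halton components of \<open>n\<close> lie in an elementary box is a congruence for
  \<open>n(X)\<close> modulo \<open>G = b\<^sub>1^d\<^sub>1 \<cdots> b\<^sub>t^d\<^sub>t\<close>. For \<open>n\<close> in a block of length \<open>p^r\<close> the solutions are
  \<open>\<rho> + k G\<close> with \<open>deg k < m = r - deg G\<close>, and the points \<open>{k G L}\<close> are equidistributed up to the
  largest order at which the Hankel matrix of \<open>G L\<close> has full rank: the counting error is at most \<open>1 + \<Sum> p^(m - deg f)\<close>, summed over the
  nonzero \<open>f\<close> with \<open>deg f < m\<close> for which the first \<open>m\<close> coefficients of \<open>{f G L}\<close> vanish. Each such event has
  probability at most \<open>p^(-m)\<close>, so after raising the summands to a power \<open>\<theta> < 1\<close> the expected error is bounded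
  independently of \<open>r\<close> and \<open>G\<close>. If \<open>N < p^R\<close>, there are \<open>O(R^(t + 1))\<close> pairs \<open>(r, G)\<close>. Since
  \<open>(\<Sum> x\<^sub>i)^\<theta> \<le> \<Sum> x\<^sub>i^\<theta>\<close>, summing the expectations over \<open>R = 2^k\<close> with weights
  \<open>R^(-(t + 1) - \<epsilon>/2)\<close> gives the almost sure bound, with \<open>\<theta>\<close> chosen so that taking the power \<open>1/\<theta>\<close> turns
  the exponent \<open>t + 1 + \<epsilon>/2\<close> into \<open>t + 1 + \<epsilon>\<close>.
\<close>

subsection \<open>Linear functionals over a finite field\<close>

text \<open>Independence provides a vector \<open>w\<close> on which the first \<open>s\<close>
  functionals vanish and the last one is 1. Translating along \<open>w\<close> cuts every fibre of
  the first \<open>s\<close> functionals into \<open>CARD('a)\<close> fibres of equal size, which is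
  the induction step.\<close>

lemma card_fibre_independent_functionals:
  fixes g :: "nat \<Rightarrow> 'a::{field,finite} poly \<Rightarrow> 'a"
  assumes fin: "finite V" and zero: "0 \<in> V"
    and V_add: "\<And>u v. u \<in> V \<Longrightarrow> v \<in> V \<Longrightarrow> u + v \<in> V"
    and V_smult: "\<And>c u. u \<in> V \<Longrightarrow> Polynomial.smult c u \<in> V"
    and g_add: "\<And>i u v. g i (u + v) = g i u + g i v"
    and g_smult: "\<And>i c u. g i (Polynomial.smult c u) = c * g i u"
    and indep: "\<And>c. (\<forall>u\<in>V. (\<Sum>i<s. c i * g i u) = 0) \<Longrightarrow> \<forall>i<s. c i = 0"
  shows "card {u\<in>V. \<forall>i<s. g i u = v i} * CARD('a) ^ s = card V"
  using indep
proof (induction s arbitrary: v)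
  case 0
  then show ?case by simp
next
  case (Suc s)
  define F where "F v = {u\<in>V. \<forall>i<s. g i u = v i}" for v :: "nat \<Rightarrow> 'a"
  have indep': "\<forall>i<s. c i = 0" if "\<forall>u\<in>V. (\<Sum>i<s. c i * g i u) = 0" for c
  proof -
    have "\<forall>i<Suc s. (c(s := 0)) i = 0"
      by (rule Suc.prems) (use that in auto)
    then show ?thesis by (metis fun_upd_other less_Suc_eq nat_neq_iff)
  qed
  have IH: "card (F v) * CARD('a) ^ s = card V" for v
    unfolding F_def by (rule Suc.IH) (rule indep')
  have "F v \<noteq> {}" for v
  proof
    assume "F v = {}"
    with IH[of v] fin zero show False by auto
  qed
  \<comment> \<open>Since every fibre is nonempty, there are vectors dual to the first
    \<open>s\<close> functionals.\<close>
  then have "\<forall>i. \<exists>u. u \<in> F (\<lambda>j. if j = i then 1 else 0)" by blast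
  then obtain u where u: "\<And>i. u i \<in> F (\<lambda>j. if j = i then 1 else 0)" by metis
  have g_sum: "g i (\<Sum>j\<in>A. h j) = (\<Sum>j\<in>A. g i (h j))" for i A and h :: "nat \<Rightarrow> 'a poly"
    using sum_comp_morphism[of "g i" h A] g_add g_smult[of i 0 0] by (simp add: o_def)
  have g_diff: "g i (x - y) = g i x - g i y" for i x y
    using g_add[of i x "Polynomial.smult (-1) y"] g_smult[of i "-1" y] by simp
  have V_sum: "(\<Sum>j\<in>A. h j) \<in> V" if "\<And>j. j \<in> A \<Longrightarrow> h j \<in> V" for A and h :: "nat \<Rightarrow> 'a poly"
    using that by (induction A rule: infinite_finite_induct) (auto simp: zero V_add)
  have V_diff: "x - y \<in> V" if "x \<in> V" "y \<in> V" for x y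
    using V_add[OF that(1) V_smult[OF that(2), of "-1"]] by simp
  \<comment> \<open>If \<open>g s\<close> vanished on the common kernel of the others, subtracting
    from \<open>x\<close> its expansion in the dual vectors would express \<open>g s\<close> through
    \<open>g 0, ..., g (s - 1)\<close>: a relation with coefficient 1 at \<open>s\<close>.\<close>
  have "\<exists>w\<in>V. (\<forall>i<s. g i w = 0) \<and> g s w \<noteq> 0"
  proof (rule ccontr)
    assume *: "\<not> ?thesis"
    define c where "c i = (if i = s then 1 else - g s (u i))" for i
    have "(\<Sum>i<Suc s. c i * g i x) = 0" if x: "x \<in> V" for x
    proof -
      define w where "w = x - (\<Sum>i<s. Polynomial.smult (g i x) (u i))"
      have "w \<in> V" unfolding w_def
        by (intro V_diff x V_sum V_smult) (use u in \<open>auto simp: F_def\<close>)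
      moreover have "g j w = 0" if "j < s" for j
      proof -
        have "g j (u i) = (if j = i then 1 else 0)" for i using u[of i] that by (auto simp: F_def)
        then show ?thesis using that by (simp add: w_def g_diff g_sum g_smult mult_delta_right)
      qed
      ultimately have "g s w = 0" using * by blast
      then show ?thesis by (simp add: w_def g_diff g_sum g_smult c_def sum_negf mult.commute)
    qed
    then have "\<forall>i<Suc s. c i = 0" by (intro Suc.prems) blast
    then show False by (auto simp: c_def)
  qed
  then obtain w0 where w0: "w0 \<in> V" "\<forall>i<s. g i w0 = 0" "g s w0 \<noteq> 0" by blast
  define w where "w = Polynomial.smult (1 / g s w0) w0"
  have w: "w \<in> V" "\<forall>i<s. g i w = 0" "g s w = 1"
    using w0 by (auto simp: w_def V_smult g_smult)
  let ?G = "{u\<in>V. \<forall>i<Suc s. g i u = v i}"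
  have "bij_betw (\<lambda>(u, x). u + Polynomial.smult x w) (?G \<times> UNIV) (F v)"
    by (rule bij_betw_byWitness[where f' = "\<lambda>u. (u - Polynomial.smult (g s u - v s) w, g s u - v s)"])
       (auto simp: F_def g_add g_smult g_diff w less_Suc_eq intro!: V_add V_diff V_smult)
  then have "card (?G \<times> (UNIV :: 'a set)) = card (F v)" by (rule bij_betw_same_card)
  then have "card ?G * CARD('a) = card (F v)" by (simp add: card_cartesian_product)
  then have "card ?G * CARD('a) * CARD('a) ^ s = card V" using IH[of v] by (simp only:)
  then show ?case by (simp only: mult.assoc power_Suc)
qed

subsection \<open>Coefficients of the fractional part of a product\<close>

text \<open>With \<open>L = a 0 / X + a 1 / X^2 + \<dots>\<close>, this is the coefficient of \<open>X^(-(k + 1))\<close> in \<open>{f L}\<close>.\<close>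
definition frac_coeff :: "(nat \<Rightarrow> 'a::comm_ring_1) \<Rightarrow> 'a poly \<Rightarrow> nat \<Rightarrow> 'a" where
  "frac_coeff a f k = (\<Sum>j\<le>degree f. Polynomial.coeff f j * a (k + j))"

lemma frac_coeff_eq_sum:
  "degree f \<le> n \<Longrightarrow> frac_coeff a f k = (\<Sum>j\<le>n. Polynomial.coeff f j * a (k + j))"
  unfolding frac_coeff_def
  by (intro sum.mono_neutral_left) (auto simp: coeff_eq_0)

lemma frac_coeff_add: "frac_coeff a (f + g) k = frac_coeff a f k + frac_coeff a g k"
proof -
  define n where "n = max (degree f) (degree g)"
  have "degree f \<le> n" "degree g \<le> n" "degree (f + g) \<le> n"
    by (auto simp: n_def degree_add_le_max)
  then show ?thesis by (simp add: frac_coeff_eq_sum ring_distribs sum.distrib)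
qed

lemma frac_coeff_smult: "frac_coeff a (Polynomial.smult c f) k = c * frac_coeff a f k"
proof -
  have "degree (Polynomial.smult c f) \<le> degree f" by (rule degree_smult_le)
  then show ?thesis by (subst frac_coeff_eq_sum, assumption) (simp add: frac_coeff_def sum_distrib_left mult_ac)
qed

lemma frac_coeff_0 [simp]: "frac_coeff a 0 k = 0"
  by (simp add: frac_coeff_def)

lemma frac_coeff_sum: "frac_coeff a (\<Sum>i\<in>A. h i) k = (\<Sum>i\<in>A. frac_coeff a (h i) k)"
  using sum_comp_morphism[of "\<lambda>f. frac_coeff a f k" h A] by (simp add: frac_coeff_add o_def)

lemma frac_coeff_pCons_0: "frac_coeff a (pCons 0 f) k = frac_coeff a f (Suc k)"
proof -
  have "degree (pCons 0 f) \<le> Suc (degree f)" by (rule degree_pCons_le)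
  then have "frac_coeff a (pCons 0 f) k = (\<Sum>j\<le>Suc (degree f). Polynomial.coeff (pCons 0 f) j * a (k + j))"
    by (rule frac_coeff_eq_sum)
  also have "\<dots> = frac_coeff a f (Suc k)"
    by (subst sum.atMost_Suc_shift) (simp add: frac_coeff_def)
  finally show ?thesis .
qed

text \<open>Multiplication by \<open>X^i\<close> shifts the Laurent coefficients by
  \<open>i\<close>. Consequently coefficient \<open>j\<close> of \<open>X^i * G * L\<close> is
  symmetric in \<open>i\<close> and \<open>j\<close>, which is the Hankel structure exploited
  below.\<close>

lemma frac_coeff_monom_mult:
  "frac_coeff a (Polynomial.monom c i * f) k = c * frac_coeff a f (k + i)"
proof (induction i arbitrary: k)
  case 0
  then show ?case by (simp add: monom_0 frac_coeff_smult)
next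
  case (Suc i)
  then show ?case by (simp add: monom_Suc frac_coeff_pCons_0)
qed

subsection \<open>Polynomials and base-p expansions\<close>

text \<open>Stated through coefficients rather than as \<open>degree f < m\<close>, so that it is a
  vector space of dimension \<open>m\<close> over the field also for \<open>m = 0\<close>, where
  only the zero polynomial remains.\<close>

definition polys_below :: "nat \<Rightarrow> 'a::zero poly set" where
  "polys_below m = {f. \<forall>i\<ge>m. Polynomial.coeff f i = 0}"

lemma polys_below_iff: "f \<in> polys_below m \<longleftrightarrow> f = 0 \<or> degree f < m"
  by (cases "f = 0") (auto simp: polys_below_def coeff_eq_0 not_less[symmetric] dest: spec[of _ "degree f"])

lemma zero_in_polys_below [simp]: "0 \<in> polys_below m"
  by (simp add: polys_below_def)

lemma polys_below_add: "f \<in> polys_below m \<Longrightarrow> g \<in> polys_below m \<Longrightarrow> f + g \<in> polys_below m"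
  by (simp add: polys_below_def)

lemma polys_below_diff:
  fixes f g :: "'a::ab_group_add poly"
  shows "f \<in> polys_below m \<Longrightarrow> g \<in> polys_below m \<Longrightarrow> f - g \<in> polys_below m"
  by (simp add: polys_below_def)

lemma polys_below_smult: "f \<in> polys_below m \<Longrightarrow> Polynomial.smult c f \<in> polys_below m"
  by (simp add: polys_below_def)

lemma polys_below_mono: "m \<le> n \<Longrightarrow> polys_below m \<subseteq> polys_below n"
  by (auto simp: polys_below_def)

lemma pCons_in_polys_below [simp]: "pCons c f \<in> polys_below (Suc m) \<longleftrightarrow> f \<in> polys_below m"
proof
  assume *: "pCons c f \<in> polys_below (Suc m)"
  have "Polynomial.coeff f i = 0" if "i \<ge> m" for i
    using *[unfolded polys_below_def] that by (auto dest!: spec[of _ "Suc i"])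
  then show "f \<in> polys_below m" by (simp add: polys_below_def)
qed (auto simp: polys_below_def coeff_pCons split: nat.splits)

lemma to_int_mod_ring_nonneg: "0 \<le> to_int_mod_ring (x :: 'p::prime_card mod_ring)"
  and to_int_mod_ring_less: "to_int_mod_ring (x :: 'p::prime_card mod_ring) < int CARD('p)"
  using range_to_int_mod_ring[where 'a='p] by auto

lemma to_int_mod_ring_of_nat:
  "to_int_mod_ring (of_nat n :: 'p::prime_card mod_ring) = int (n mod CARD('p))"
proof -
  have "of_nat n = (of_nat (n mod CARD('p)) :: 'p mod_ring)"
  proof -
    have "(of_nat n :: 'p mod_ring) = of_nat (n div CARD('p) * CARD('p) + n mod CARD('p))" by simp
    then show ?thesis unfolding of_nat_add of_nat_mult by simp
  qed
  then show ?thesis by (simp add: of_nat_of_int_mod_ring)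
qed

lemma of_nat_to_int_mod_ring:
  "(of_nat (nat (to_int_mod_ring x)) :: 'p::prime_card mod_ring) = x"
  by (simp add: of_nat_of_int_mod_ring to_int_mod_ring_nonneg)

lemma of_nat_mod_CARD: "(of_nat (n mod CARD('p)) :: 'p::prime_card mod_ring) = of_nat n"
  using to_int_mod_ring_of_nat[of "n mod CARD('p)", where 'p='p] to_int_mod_ring_of_nat[of n, where 'p='p]
  by (metis mod_mod_trivial to_int_mod_ring_hom.injectivity)

lemma card_p_gt_1: "CARD('p::prime_card) > 1"
  by (rule prime_gt_1_nat[OF prime_card])

lemma coeff_nat_poly:
  "Polynomial.coeff (nat_poly n :: 'p::prime_card mod_ring poly) k = of_nat (n div CARD('p) ^ k mod CARD('p))"
proof (cases "k < Suc n")
  case True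
  then show ?thesis by (simp add: nat_poly_def coeff_sum)
next
  case False
  have "k < CARD('p) ^ k" by (rule power_gt_expt) (use card_p_gt_1[where 'p='p] in auto)
  with False have "n div CARD('p) ^ k = 0" by simp
  with False show ?thesis by (simp add: nat_poly_def coeff_sum)
qed

lemma nat_poly_0 [simp]: "nat_poly 0 = 0"
  by (simp add: poly_eq_iff coeff_nat_poly)

lemma nat_poly_add_mult:
  "(nat_poly (i + CARD('p) * n) :: 'p::prime_card mod_ring poly) = pCons (of_nat i) (nat_poly n)" if "i < CARD('p)"
  using that
  by (simp add: poly_eq_iff coeff_nat_poly coeff_pCons of_nat_mod_CARD div_mult2_eq split: nat.splits)

lemma nat_poly_rec:
  "(nat_poly n :: 'p::prime_card mod_ring poly) = pCons (of_nat (n mod CARD('p))) (nat_poly (n div CARD('p)))"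
  using nat_poly_add_mult[of "n mod CARD('p)" "n div CARD('p)", where 'p='p] card_p_gt_1[where 'p='p] by simp

text \<open>The last \<open>r\<close> base-p digits of \<open>M * p^r\<close> are zero, so adding
  \<open>l\<close> causes no carry and integer addition agrees with polynomial addition. A block of
  \<open>p^r\<close> consecutive integers thus becomes a coset of
  \<open>polys_below r\<close>.\<close>

lemma nat_poly_block:
  assumes "l < CARD('p) ^ r"
  shows "(nat_poly (M * CARD('p) ^ r + l) :: 'p::prime_card mod_ring poly)
           = nat_poly (M * CARD('p) ^ r) + nat_poly l"
  using assms
proof (induction r arbitrary: l)
  case 0
  then show ?case by simp
next
  case (Suc r)
  let ?p = "CARD('p)"
  have p: "?p > 1" by (rule card_p_gt_1)
  have l: "l div ?p < ?p ^ r" using Suc.prems p by (simp add: less_mult_imp_div_less mult.commute)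
  have 1: "M * ?p ^ Suc r + l = l mod ?p + ?p * (M * ?p ^ r + l div ?p)"
    by (simp add: algebra_simps)
  have 2: "M * ?p ^ Suc r = 0 + ?p * (M * ?p ^ r)" by simp
  have "nat_poly (M * ?p ^ Suc r + l) = pCons (of_nat (l mod ?p)) (nat_poly (M * ?p ^ r + l div ?p) :: 'p mod_ring poly)"
    unfolding 1 by (rule nat_poly_add_mult) (use p in auto)
  also have "\<dots> = pCons 0 (nat_poly (M * ?p ^ r)) + pCons (of_nat (l mod ?p)) (nat_poly (l div ?p))"
    by (simp add: Suc.IH[OF l])
  also have "pCons 0 (nat_poly (M * ?p ^ r)) = (nat_poly (M * ?p ^ Suc r) :: 'p mod_ring poly)"
    unfolding 2 by (subst nat_poly_add_mult) (use p in auto)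
  also have "pCons (of_nat (l mod ?p)) (nat_poly (l div ?p)) = (nat_poly l :: 'p mod_ring poly)"
    by (rule nat_poly_rec[symmetric])
  finally show ?case .
qed

lemma nat_poly_in_polys_below: "n < CARD('p) ^ m \<Longrightarrow> (nat_poly n :: 'p::prime_card mod_ring poly) \<in> polys_below m"
proof -
  assume n: "n < CARD('p) ^ m"
  have "n < CARD('p) ^ i" if "i \<ge> m" for i
    using power_increasing[OF that, of "CARD('p)"] card_p_gt_1[where 'p='p] n by linarith
  then show ?thesis by (simp add: polys_below_def coeff_nat_poly)
qed

lemma eval_at_p_pCons:
  fixes f :: "'p::prime_card mod_ring poly"
  shows "eval_at_p (pCons c f) = real_of_int (to_int_mod_ring c) + real CARD('p) * eval_at_p f"
proof -
  have *: "eval_at_p f = (\<Sum>k\<le>n. real_of_int (to_int_mod_ring (Polynomial.coeff f k)) * real CARD('p) ^ k)"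
    if "degree f \<le> n" for n and f :: "'p mod_ring poly"
    unfolding eval_at_p_def using that by (intro sum.mono_neutral_left) (auto simp: coeff_eq_0)
  show ?thesis
    by (subst *[OF degree_pCons_le], subst sum.atMost_Suc_shift)
       (simp add: *[of f, OF order.refl] sum_distrib_left mult_ac)
qed

text \<open>Evaluation at p undoes the passage from integers to polynomials. This yields injectivity
  of \<open>nat_poly\<close> and later turns the digit polynomials of the van der Corput sequence
  into integers.\<close>

lemma eval_at_p_nat_poly: "eval_at_p (nat_poly n :: 'p::prime_card mod_ring poly) = real n"
proof (induction n rule: less_induct)
  case (less n)
  let ?p = "CARD('p)"
  have p: "?p > 1" by (rule card_p_gt_1)
  show ?case
  proof (cases "n = 0")
    case True
    then show ?thesis by (simp add: eval_at_p_def)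
  next
    case False
    then have "n div ?p < n" using p by simp
    from less.IH[OF this] have "eval_at_p (nat_poly n :: 'p mod_ring poly) = real (n mod ?p) + real ?p * real (n div ?p)"
      by (subst nat_poly_rec) (simp add: eval_at_p_pCons to_int_mod_ring_of_nat)
    also have "\<dots> = real n" 
      by (metis mod_mult_div_eq of_nat_add of_nat_mult)
    finally show ?thesis .
  qed
qed

lemma polys_below_eq_nat_poly_image:
  "polys_below m = (nat_poly ` {..<CARD('p) ^ m} :: 'p::prime_card mod_ring poly set)"
proof
  show "polys_below m \<subseteq> (nat_poly ` {..<CARD('p) ^ m} :: 'p mod_ring poly set)"
  proof (induction m)
    case 0
    then show ?case by (auto simp: polys_below_iff)
  next
    case (Suc m)
    show ?case
    proof
      fix f :: "'p mod_ring poly" assume f: "f \<in> polys_below (Suc m)"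
      obtain c g where fc: "f = pCons c g" by (cases f) auto
      with f have "g \<in> polys_below m" by simp
      with Suc.IH obtain n where n: "n < CARD('p) ^ m" "g = nat_poly n" by auto
      define i where "i = nat (to_int_mod_ring c)"
      have i: "i < CARD('p)" using to_int_mod_ring_less[of c] to_int_mod_ring_nonneg[of c] by (simp add: i_def nat_less_iff)
      have "i + CARD('p) * n < CARD('p) ^ Suc m"
      proof -
        have "i + CARD('p) * n < CARD('p) * Suc n" using i by simp
        also have "\<dots> \<le> CARD('p) * CARD('p) ^ m" using n by (intro mult_le_mono2) simp
        finally show ?thesis by simp
      qed
      moreover have "f = nat_poly (i + CARD('p) * n)"
        using i n by (simp add: nat_poly_add_mult fc i_def of_nat_to_int_mod_ring)
      ultimately show "f \<in> nat_poly ` {..<CARD('p) ^ Suc m}" by blast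
    qed
  qed
qed (auto simp: nat_poly_in_polys_below)

lemma inj_nat_poly: "inj (nat_poly :: nat \<Rightarrow> 'p::prime_card mod_ring poly)"
  by (rule injI) (metis eval_at_p_nat_poly of_nat_eq_iff)

lemma finite_polys_below [simp]: "finite (polys_below m :: 'p::prime_card mod_ring poly set)"
  by (simp add: polys_below_eq_nat_poly_image)

lemma card_polys_below: "card (polys_below m :: 'p::prime_card mod_ring poly set) = CARD('p) ^ m"
  by (simp add: polys_below_eq_nat_poly_image card_image inj_on_subset[OF inj_nat_poly])

subsection \<open>The Kronecker component on residue classes\<close>

text \<open>The integer whose base-p digits are the first \<open>s\<close> coefficients of
  \<open>{f L}\<close>; it names the elementary interval of length \<open>p^(-s)\<close> that
  contains the Kronecker point.\<close>

primrec kron_int :: "(nat \<Rightarrow> 'p::prime_card mod_ring) \<Rightarrow> 'p mod_ring poly \<Rightarrow> nat \<Rightarrow> nat" where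
  "kron_int a f 0 = 0"
| "kron_int a f (Suc s) = CARD('p) * kron_int a f s + nat (to_int_mod_ring (frac_coeff a f s))"

definition kron_val :: "(nat \<Rightarrow> 'p::prime_card mod_ring) \<Rightarrow> 'p mod_ring poly \<Rightarrow> real" where
  "kron_val a f = (\<Sum>k. real_of_int (to_int_mod_ring (frac_coeff a f k)) / real CARD('p) ^ Suc k)"

lemma kronecker_eq_kron_val: "kronecker a n = kron_val a (nat_poly n)"
  by (simp add: kronecker_def kron_val_def kron_digit_def frac_coeff_def)

lemma nat_to_int_mod_ring_less: "nat (to_int_mod_ring (x :: 'p::prime_card mod_ring)) < CARD('p)"
  using to_int_mod_ring_less[of x] to_int_mod_ring_nonneg[of x] by (simp add: nat_less_iff)

lemma mult_add_less_power_Suc: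
  fixes y e q s :: nat
  assumes "y < q ^ s" "e < q"
  shows "q * y + e < q ^ Suc s"
proof -
  have "q * y + e < q * Suc y" using assms by simp
  also have "\<dots> \<le> q * q ^ s" using assms by (intro mult_le_mono2) simp
  finally show ?thesis by simp
qed

lemma kron_int_less: "kron_int a (f :: 'p::prime_card mod_ring poly) s < CARD('p) ^ s"
proof (induction s)
  case (Suc s)
  then show ?case
    unfolding kron_int.simps by (rule mult_add_less_power_Suc) (rule nat_to_int_mod_ring_less)
qed simp

text \<open>Choosing an elementary interval prescribes the first \<open>s\<close> coefficients,
  namely as the base-p digits of \<open>y\<close>. The same \<open>v\<close> serves all
  \<open>f\<close>, so the condition is a system of linear equations in \<open>f\<close>.\<close>

lemma kron_int_eq_iff:
  fixes a :: "nat \<Rightarrow> 'p::prime_card mod_ring"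
  assumes "y < CARD('p) ^ s"
  shows "\<exists>v. \<forall>f. kron_int a f s = y \<longleftrightarrow> (\<forall>i<s. frac_coeff a f i = v i)"
  using assms
proof (induction s arbitrary: y)
  case 0
  then show ?case by simp
next
  case (Suc s)
  let ?p = "CARD('p)"
  have "y div ?p < ?p ^ s" using Suc.prems by (simp add: less_mult_imp_div_less mult.commute)
  from Suc.IH[OF this] obtain v where v: "\<And>f. kron_int a f s = y div ?p \<longleftrightarrow> (\<forall>i<s. frac_coeff a f i = v i)"
    by blast
  have "kron_int a f (Suc s) = y \<longleftrightarrow> (\<forall>i<Suc s. frac_coeff a f i = (v(s := of_nat (y mod ?p))) i)" for f
  proof -
    let ?e = "nat (to_int_mod_ring (frac_coeff a f s))"
    have e: "?e < ?p" by (rule nat_to_int_mod_ring_less)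
    have "kron_int a f (Suc s) = y \<longleftrightarrow> kron_int a f s = y div ?p \<and> ?e = y mod ?p"
      using e by (auto simp: mult.commute)
    also have "?e = y mod ?p \<longleftrightarrow> frac_coeff a f s = of_nat (y mod ?p)"
      by (metis mod_mod_trivial nat_int of_nat_to_int_mod_ring to_int_mod_ring_of_nat)
    finally show ?thesis using v by (auto simp: less_Suc_eq)
  qed
  then show ?case by blast
qed

text \<open>The digits from position \<open>s\<close> on contribute at most \<open>(p - 1)\<close>
  times a geometric series, that is \<open>p^(-s)\<close>. The upper bound is not strict because all
  these digits may equal \<open>p - 1\<close>.\<close>

lemma kron_val_bounds:
  fixes a :: "nat \<Rightarrow> 'p::prime_card mod_ring"
  shows "real (kron_int a f s) / real CARD('p) ^ s \<le> kron_val a f"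
    and "kron_val a f \<le> (real (kron_int a f s) + 1) / real CARD('p) ^ s"
proof -
  let ?p = "real CARD('p)"
  define g where "g k = real_of_int (to_int_mod_ring (frac_coeff a f k)) / ?p ^ Suc k" for k
  have p: "?p > 1" using card_p_gt_1[where 'p='p] by linarith
  have g0: "g k \<ge> 0" for k by (simp add: g_def to_int_mod_ring_nonneg)
  have g1: "g k \<le> (?p - 1) * (1 / ?p) ^ Suc k" for k
  proof -
    have "real_of_int (to_int_mod_ring (frac_coeff a f k)) \<le> ?p - 1"
      using to_int_mod_ring_less[of "frac_coeff a f k"] by linarith
    then show ?thesis using p by (simp add: g_def field_simps)
  qed
  have geo: "(\<lambda>k. (?p - 1) * (1 / ?p) ^ Suc (k + s)) sums (1 / ?p ^ s)"
  proof -
    have "(\<lambda>k. (1 / ?p) ^ k) sums (1 / (1 - 1 / ?p))"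
      by (rule geometric_sums) (use p in auto)
    then have "(\<lambda>k. (?p - 1) * (1 / ?p) ^ Suc s * (1 / ?p) ^ k) sums ((?p - 1) * (1 / ?p) ^ Suc s * (1 / (1 - 1 / ?p)))"
      by (rule sums_mult)
    moreover have "(?p - 1) * (1 / ?p) ^ Suc s * (1 / (1 - 1 / ?p)) = 1 / ?p ^ s"
      using p by (simp add: field_simps)
    moreover have "(?p - 1) * (1 / ?p) ^ Suc s * (1 / ?p) ^ k = (?p - 1) * (1 / ?p) ^ Suc (k + s)" for k
      by (simp add: power_add)
    ultimately show ?thesis by (simp only:)
  qed
  have summ: "summable (\<lambda>k. g (k + s))"
    by (rule summable_comparison_test'[OF sums_summable[OF geo], of 0]) (use g0 g1 in auto)
  then have "summable g" by (simp add: summable_iff_shift)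
  have init: "(\<Sum>k<s. g k) = real (kron_int a f s) / ?p ^ s" for s
  proof (induction s)
    case (Suc s)
    have "real (kron_int a f (Suc s)) / ?p ^ Suc s = real (kron_int a f s) / ?p ^ s + g s"
      using p by (simp add: g_def field_simps of_nat_nat[OF to_int_mod_ring_nonneg])
    then show ?case using Suc by simp
  qed simp
  have kv: "kron_val a f = suminf g" by (simp only: kron_val_def g_def[abs_def])
  have "kron_val a f = (\<Sum>k. g (k + s)) + real (kron_int a f s) / ?p ^ s"
    using suminf_split_initial_segment[OF \<open>summable g\<close>, of s] by (simp add: kv init)
  moreover have "(\<Sum>k. g (k + s)) \<ge> 0" by (rule suminf_nonneg[OF summ]) (rule g0)
  moreover have "(\<Sum>k. g (k + s)) \<le> 1 / ?p ^ s"
    using suminf_le[OF _ summ sums_summable[OF geo]] g1 sums_unique[OF geo] by simp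
  ultimately show "real (kron_int a f s) / ?p ^ s \<le> kron_val a f" "kron_val a f \<le> (real (kron_int a f s) + 1) / ?p ^ s"
    by (auto simp: add_divide_distrib)
qed

text \<open>By Hankel symmetry, a linear relation with coefficients \<open>c i\<close> among the
  \<open>s\<close> coefficient functionals on multiples of \<open>G\<close> is a polynomial
  \<open>f\<close> of degree below \<open>s\<close> for which the first \<open>m\<close>
  coefficients of \<open>{f G L}\<close> vanish. The hypothesis excludes nonzero \<open>f\<close> of
  this kind, so the functionals are independent.\<close>

lemma card_frac_coeff_fibre:
  fixes a :: "nat \<Rightarrow> 'p::prime_card mod_ring"
  assumes "\<And>f. f \<in> polys_below s \<Longrightarrow> (\<forall>j<m. frac_coeff a (f * G) j = 0) \<Longrightarrow> f = 0"
  shows "card {k\<in>polys_below m. \<forall>i<s. frac_coeff a (\<rho> + k * G) i = v i} * CARD('p) ^ s = CARD('p) ^ m"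
proof -
  have "card {k\<in>polys_below m. \<forall>i<s. frac_coeff a (k * G) i = v i - frac_coeff a \<rho> i} * CARD('p mod_ring) ^ s
        = card (polys_below m :: 'p mod_ring poly set)"
  proof (rule card_fibre_independent_functionals)
    fix c assume c: "\<forall>u\<in>polys_below m. (\<Sum>i<s. c i * frac_coeff a (u * G) i) = 0"
    define f where "f = (\<Sum>i<s. Polynomial.monom (c i) i)"
    have coeff_f: "Polynomial.coeff f i = (if i < s then c i else 0)" for i
      by (simp add: f_def coeff_sum)
    have "f \<in> polys_below s" by (simp add: polys_below_def coeff_f)
    moreover have "frac_coeff a (f * G) j = 0" if "j < m" for j
    proof -
      \<comment> \<open>Testing the relation on \<open>X^j\<close> gives exactly coefficient
        \<open>j\<close> of \<open>{f G L}\<close>.\<close>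
      have "Polynomial.monom 1 j \<in> polys_below m" using that by (simp add: polys_below_def)
      with c have "(\<Sum>i<s. c i * frac_coeff a (Polynomial.monom 1 j * G) i) = 0" by blast
      then show ?thesis
        by (simp add: f_def sum_distrib_right frac_coeff_sum frac_coeff_monom_mult add.commute)
    qed
    ultimately have "f = 0" using assms by blast
    then show "\<forall>i<s. c i = 0" using coeff_f by (metis coeff_0)
  qed (auto simp: frac_coeff_add frac_coeff_smult distrib_right polys_below_add polys_below_smult)
  then show ?thesis by (simp add: card_polys_below frac_coeff_add eq_diff_eq add.commute)
qed

text \<open>Each of the \<open>q\<close> cells of length \<open>1 / q\<close> holds exactly
  \<open>c\<close> points, and the cells to the left of \<beta> count in full. Only the one cell in
  which \<beta> falls is uncertain, so the error is at most \<open>c\<close>.\<close>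

lemma equidistributed_digits_count:
  fixes H :: "'a \<Rightarrow> nat" and x :: "'a \<Rightarrow> real"
  assumes V: "finite V" and q: "q > 0"
    and c: "\<And>y. y < q \<Longrightarrow> card {k\<in>V. H k = y} = c"
    and H: "\<And>k. k \<in> V \<Longrightarrow> H k < q"
    and x: "\<And>k. k \<in> V \<Longrightarrow> real (H k) / real q \<le> x k" "\<And>k. k \<in> V \<Longrightarrow> x k \<le> (real (H k) + 1) / real q"
    and \<beta>: "0 \<le> \<beta>" "\<beta> \<le> 1"
  shows "\<bar>real (card {k\<in>V. x k < \<beta>}) - real (card V) * \<beta>\<bar> \<le> real c"
proof -
  have less: "card {k\<in>V. H k < J} = c * J" if "J \<le> q" for J
    using that
  proof (induction J)
    case (Suc J)
    have "{k\<in>V. H k < Suc J} = {k\<in>V. H k < J} \<union> {k\<in>V. H k = J}" by auto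
    also have "card \<dots> = card {k\<in>V. H k < J} + card {k\<in>V. H k = J}"
      by (rule card_Un_disjoint) (use V in auto)
    finally show ?case using Suc c[of J] by simp
  qed simp
  have "{k\<in>V. H k < q} = V" using H by auto
  with less[of q] have cV: "real (card V) = real c * real q" by simp
  define t where "t = \<beta> * real q"
  have t: "0 \<le> t" "t \<le> real q" using \<beta> q by (auto simp: t_def mult_left_le_one_le)
  define J where "J = nat \<lceil>t\<rceil>"
  have J: "J \<le> q" "t \<le> real J" "real J < t + 1" using t by (auto simp: J_def ceiling_le_iff) linarith+
  have "{k\<in>V. x k < \<beta>} \<subseteq> {k\<in>V. H k < J}"
  proof safe
    fix k assume k: "k \<in> V" "x k < \<beta>"
    then have "real (H k) / real q < \<beta>" using x(1)[of k] by linarith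
    then have "real (H k) < t" using q by (simp add: t_def field_simps)
    then show "H k < J" using J by linarith
  qed
  then have "card {k\<in>V. x k < \<beta>} \<le> card {k\<in>V. H k < J}" using V by (intro card_mono) auto
  then have "real (card {k\<in>V. x k < \<beta>}) \<le> real c * real J"
    unfolding less[OF J(1)] by (metis of_nat_le_iff of_nat_mult)
  also have "\<dots> \<le> real c * (t + 1)" using J by (intro mult_left_mono) auto
  finally have up: "real (card {k\<in>V. x k < \<beta>}) \<le> real c * (t + 1)" .
  \<comment> \<open>Dropping the last cell leaves a strict gap to \<beta>, which absorbs the
    non-strict upper bound on \<open>x\<close>. For \<open>J = 0\<close> truncated subtraction
    leaves an empty set.\<close>
  have "{k\<in>V. H k < J - 1} \<subseteq> {k\<in>V. x k < \<beta>}"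
  proof safe
    fix k assume k: "k \<in> V" "H k < J - 1"
    then have "real (H k) + 1 < t" using J by linarith
    then have "(real (H k) + 1) / real q < \<beta>" using q by (simp add: t_def field_simps)
    then show "x k < \<beta>" using x(2)[OF k(1)] by linarith
  qed
  then have "card {k\<in>V. H k < J - 1} \<le> card {k\<in>V. x k < \<beta>}" using V by (intro card_mono) auto
  moreover have "card {k\<in>V. H k < J - 1} = c * (J - 1)" by (rule less) (use J in simp)
  ultimately have "real (c * (J - 1)) \<le> real (card {k\<in>V. x k < \<beta>})" by (simp only: of_nat_le_iff)
  then have "real c * real (J - 1) \<le> real (card {k\<in>V. x k < \<beta>})" by (simp only: of_nat_mult)
  moreover have "real c * (t - 1) \<le> real c * real (J - 1)" using J by (intro mult_left_mono) auto
  ultimately have lo: "real c * (t - 1) \<le> real (card {k\<in>V. x k < \<beta>})" by linarith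
  have "real (card V) * \<beta> = real c * t" by (simp add: cV t_def)
  then show ?thesis using up lo by (simp add: algebra_simps abs_le_iff)
qed

section \<open>Rank deficiency and the counting error in a residue class\<close>

text \<open>The nonzero \<open>f\<close> in this sum witness that the Hankel matrix of \<open>G L\<close> is rank deficient:
  they are denominators of good rational approximations to \<open>G L\<close>.\<close>
definition approx_sum :: "real \<Rightarrow> (nat \<Rightarrow> 'p::prime_card mod_ring) \<Rightarrow> nat \<Rightarrow> 'p mod_ring poly \<Rightarrow> real" where
  "approx_sum \<theta> a m G = 1 + (\<Sum>f\<in>polys_below m - {0}.
     if \<forall>j<m. frac_coeff a (f * G) j = 0 then real CARD('p) powr (\<theta> * real (m - degree f)) else 0)"

lemma approx_sum_ge_1: "approx_sum \<theta> a m G \<ge> 1"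
  unfolding approx_sum_def by (simp add: sum_nonneg)

text \<open>Equidistribution up to order \<open>s\<close> gives the error \<open>p^(m - s)\<close>.
  At the largest usable \<open>s\<close>, either \<open>s = m\<close> and the error is at most 1,
  the constant summand of \<open>approx_sum\<close>, or a nonzero \<open>f\<close> of degree at most
  \<open>s\<close> obstructs the next order, and its own summand \<open>p^(m - degree f)\<close>
  covers the error.\<close>

lemma kron_val_count_multiples:
  fixes a :: "nat \<Rightarrow> 'p::prime_card mod_ring"
  assumes \<beta>: "0 \<le> \<beta>" "\<beta> \<le> 1"
  shows "\<bar>real (card {k\<in>polys_below m. kron_val a (\<rho> + k * G) < \<beta>}) - real CARD('p) ^ m * \<beta>\<bar> \<le> approx_sum 1 a m G"
proof -
  let ?p = "CARD('p)"
  let ?bad = "\<lambda>f. \<forall>j<m. frac_coeff a (f * G) j = 0"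
  have p: "?p > 1" by (rule card_p_gt_1)
  have main: "\<bar>real (card {k\<in>polys_below m. kron_val a (\<rho> + k * G) < \<beta>}) - real ?p ^ m * \<beta>\<bar> \<le> real ?p ^ (m - s)"
    if s: "s \<le> m" and nobad: "\<And>f. f \<in> polys_below s \<Longrightarrow> ?bad f \<Longrightarrow> f = 0" for s
  proof -
    have "card {k\<in>polys_below m. kron_int a (\<rho> + k * G) s = y} = ?p ^ (m - s)" if y: "y < ?p ^ s" for y
    proof -
      from kron_int_eq_iff[OF y] obtain v
        where v: "\<And>f. kron_int a f s = y \<longleftrightarrow> (\<forall>i<s. frac_coeff a f i = v i)" by blast
      have "card {k\<in>polys_below m. kron_int a (\<rho> + k * G) s = y} * ?p ^ s = ?p ^ (m - s) * ?p ^ s"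
        unfolding v using card_frac_coeff_fibre[OF nobad, where \<rho>=\<rho> and v=v] s
        by (simp flip: power_add)
      then show ?thesis using p by simp
    qed
    from equidistributed_digits_count[OF _ _ this, where \<beta> = \<beta> and q = "?p ^ s"
        and x = "\<lambda>k. kron_val a (\<rho> + k * G)"]
    show ?thesis using p \<beta> kron_val_bounds[of a _ s] kron_int_less[of a]
      by (simp add: card_polys_below)
  qed
  define P where "P s \<longleftrightarrow> (\<exists>f\<in>polys_below s - {0}. ?bad f)" for s
  show ?thesis
  proof (cases "P m")
    case False
    then have "\<bar>real (card {k\<in>polys_below m. kron_val a (\<rho> + k * G) < \<beta>}) - real ?p ^ m * \<beta>\<bar> \<le> 1"
      using main[OF order.refl] by (simp add: P_def) blast
    then show ?thesis using approx_sum_ge_1[of 1 a m G] by linarith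
  next
    case True
    \<comment> \<open>By minimality the order \<open>s - 1\<close> is still free of obstructions,
      while an obstructing \<open>f\<close> of degree at most \<open>s - 1\<close> exists.\<close>
    define s where "s = (LEAST s. P s)"
    have Ps: "P s" unfolding s_def using True by (rule LeastI)
    have sm: "s \<le> m" unfolding s_def using True by (rule Least_le)
    have "\<not> P 0" by (auto simp: P_def polys_below_iff)
    with Ps have "s \<noteq> 0" by metis
    then have "\<not> P (s - 1)" unfolding s_def by (intro not_less_Least) simp
    then have 1: "\<bar>real (card {k\<in>polys_below m. kron_val a (\<rho> + k * G) < \<beta>}) - real ?p ^ m * \<beta>\<bar> \<le> real ?p ^ (m - (s - 1))"
      using sm by (intro main) (auto simp: P_def)
    from Ps obtain f where f: "f \<in> polys_below s" "f \<noteq> 0" "?bad f" by (auto simp: P_def)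
    then have "degree f < s" by (simp add: polys_below_iff)
    then have "real ?p ^ (m - (s - 1)) \<le> real ?p ^ (m - degree f)"
      using p by (intro power_increasing) auto
    also have "\<dots> = (if ?bad f then real ?p powr (1 * real (m - degree f)) else 0)"
      using f p by (simp add: powr_realpow)
    also have "\<dots> \<le> (\<Sum>f\<in>polys_below m - {0}. if ?bad f then real ?p powr (1 * real (m - degree f)) else 0)"
      using f polys_below_mono[OF sm] by (intro member_le_sum) auto
    also have "\<dots> \<le> approx_sum 1 a m G" by (simp add: approx_sum_def)
    finally show ?thesis using 1 by linarith
  qed
qed

lemma mult_in_polys_below_iff:
  fixes k G :: "'a::field poly"
  assumes "G \<noteq> 0"
  shows "k * G \<in> polys_below (m + degree G) \<longleftrightarrow> k \<in> polys_below m"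
  using assms by (cases "k = 0") (simp_all add: polys_below_iff degree_mult_eq)

text \<open>Within the block the solutions of the congruence are \<open>C + \<sigma> + k * G\<close>
  with \<open>k\<close> in \<open>polys_below m\<close>. If \<open>degree G > r\<close>, two
  solutions would differ by a multiple of \<open>G\<close> of too small a degree, so there is at
  most one; the main term is then at most 1 as well, and the constant summand of
  \<open>approx_sum\<close> suffices.\<close>

lemma kron_val_count_residue_class:
  fixes a :: "nat \<Rightarrow> 'p::prime_card mod_ring" and G :: "'p mod_ring poly"
  assumes G: "G \<noteq> 0" and \<beta>: "0 \<le> \<beta>" "\<beta> \<le> 1"
  shows "\<bar>real (card {f. f - C \<in> polys_below r \<and> G dvd f - \<rho> \<and> kron_val a f < \<beta>})
           - real CARD('p) ^ r / real CARD('p) ^ degree G * \<beta>\<bar> \<le> approx_sum 1 a (r - degree G) G"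
proof (cases "degree G \<le> r")
  case True
  define m where "m = r - degree G"
  have r: "r = m + degree G" using True by (simp add: m_def)
  \<comment> \<open>Reduction modulo \<open>G\<close> keeps the representative
    \<open>C + \<sigma>\<close> of the class of \<rho> inside the block.\<close>
  define \<sigma> where "\<sigma> = (\<rho> - C) mod G"
  have \<sigma>: "\<sigma> \<in> polys_below r"
    using degree_mod_less[OF G, of "\<rho> - C"] by (auto simp: \<sigma>_def polys_below_iff r)
  have G\<sigma>: "G dvd \<rho> - C - \<sigma>" by (simp add: \<sigma>_def dvd_minus_mod)
  have "bij_betw (\<lambda>k. C + \<sigma> + k * G) {k\<in>polys_below m. kron_val a (C + \<sigma> + k * G) < \<beta>}
          {f. f - C \<in> polys_below r \<and> G dvd f - \<rho> \<and> kron_val a f < \<beta>}"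
  proof (rule bij_betw_imageI)
    show "inj_on (\<lambda>k. C + \<sigma> + k * G) {k\<in>polys_below m. kron_val a (C + \<sigma> + k * G) < \<beta>}"
      using G by (auto intro: inj_onI)
    show "(\<lambda>k. C + \<sigma> + k * G) ` {k\<in>polys_below m. kron_val a (C + \<sigma> + k * G) < \<beta>}
          = {f. f - C \<in> polys_below r \<and> G dvd f - \<rho> \<and> kron_val a f < \<beta>}" (is "?A = ?B")
    proof (intro equalityI subsetI)
      fix f assume "f \<in> ?A"
      then obtain k where k: "k \<in> polys_below m" "kron_val a (C + \<sigma> + k * G) < \<beta>" "f = C + \<sigma> + k * G" by auto
      have "k * G \<in> polys_below r" using k(1) G by (simp add: r mult_in_polys_below_iff)
      with \<sigma> have "\<sigma> + k * G \<in> polys_below r" by (rule polys_below_add)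
      moreover have "G dvd k * G - (\<rho> - C - \<sigma>)" by (intro dvd_diff G\<sigma>) simp
      ultimately show "f \<in> ?B" using k by (simp add: algebra_simps)
    next
      fix f assume f: "f \<in> ?B"
      have "G dvd (f - \<rho>) + (\<rho> - C - \<sigma>)" using f G\<sigma> by (intro dvd_add) auto
      then have "G dvd f - C - \<sigma>" by (simp add: algebra_simps)
      then obtain k where k: "f - C - \<sigma> = k * G" by (metis dvd_def mult.commute)
      have "f - C - \<sigma> \<in> polys_below r" using f \<sigma> by (simp add: polys_below_diff del: diff_diff_eq diff_diff_add)
      then have "k \<in> polys_below m" unfolding k using G by (simp add: r mult_in_polys_below_iff)
      moreover have "f = C + \<sigma> + k * G" using k by (simp add: algebra_simps)
      ultimately show "f \<in> ?A" using f by auto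
    qed
  qed
  then have "card {k\<in>polys_below m. kron_val a (C + \<sigma> + k * G) < \<beta>}
      = card {f. f - C \<in> polys_below r \<and> G dvd f - \<rho> \<and> kron_val a f < \<beta>}" by (rule bij_betw_same_card)
  moreover have "real CARD('p) ^ r / real CARD('p) ^ degree G = real CARD('p) ^ m"
    by (simp add: r power_add)
  ultimately show ?thesis
    using kron_val_count_multiples[OF \<beta>, of m a "C + \<sigma>" G] by (simp add: m_def)
next
  case False
  let ?B = "{f. f - C \<in> polys_below r \<and> G dvd f - \<rho> \<and> kron_val a f < \<beta>}"
  have "f = g" if "f \<in> ?B" "g \<in> ?B" for f g
  proof (rule ccontr)
    assume "f \<noteq> g"
    have "G dvd (f - \<rho>) - (g - \<rho>)" using that by (blast intro: dvd_diff)
    then have "G dvd f - g" by simp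
    then have "degree G \<le> degree (f - g)" using \<open>f \<noteq> g\<close> by (intro dvd_imp_degree_le) auto
    moreover have "(f - C) - (g - C) \<in> polys_below r" using that by (blast intro: polys_below_diff)
    ultimately show False using False \<open>f \<noteq> g\<close> by (simp add: polys_below_iff)
  qed
  then have "\<exists>f. ?B \<subseteq> {f}" by blast
  then obtain f where "?B \<subseteq> {f}" by blast
  then have "card ?B \<le> card {f}" by (intro card_mono) auto
  then have 1: "real (card ?B) \<le> 1" by simp
  have p: "real CARD('p) \<ge> 1" using card_p_gt_1[where 'p='p] by linarith
  have "real CARD('p) ^ r \<le> real CARD('p) ^ degree G" using False p by (intro power_increasing) auto
  then have "real CARD('p) ^ r / real CARD('p) ^ degree G \<le> 1" using p by (simp add: divide_le_eq_1)
  then have "real CARD('p) ^ r / real CARD('p) ^ degree G * \<beta> \<le> 1" using \<beta> by (intro mult_le_one) auto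
  moreover have "real CARD('p) ^ r / real CARD('p) ^ degree G * \<beta> \<ge> 0" using \<beta> by simp
  ultimately have "\<bar>real (card ?B) - real CARD('p) ^ r / real CARD('p) ^ degree G * \<beta>\<bar> \<le> 1"
    using 1 by linarith
  then show ?thesis using approx_sum_ge_1[of 1 a "r - degree G" G] by linarith
qed

subsection \<open>The van der Corput components and residue classes\<close>

definition nat_of_poly :: "'p::prime_card mod_ring poly \<Rightarrow> nat" where
  "nat_of_poly = inv_into UNIV nat_poly"

text \<open>The counterpart of \<open>kron_int\<close>: the integer formed in base
  \<open>p^(degree b)\<close> by the first \<open>K\<close> digits of the van der Corput point, that
  is, by the \<open>K\<close> lowest b-adic digits of \<open>f\<close>.\<close>

primrec vdc_int :: "'p::prime_card mod_ring poly \<Rightarrow> 'p mod_ring poly \<Rightarrow> nat \<Rightarrow> nat" where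
  "vdc_int b f 0 = 0"
| "vdc_int b f (Suc K) = CARD('p) ^ degree b * vdc_int b f K + nat_of_poly ((f div b ^ K) mod b)"

lemma nat_of_poly_nat_poly [simp]: "nat_of_poly (nat_poly n :: 'p::prime_card mod_ring poly) = n"
  unfolding nat_of_poly_def by (rule inv_f_f[OF inj_nat_poly])

lemma nat_poly_nat_of_poly [simp]: "nat_poly (nat_of_poly f) = (f :: 'p::prime_card mod_ring poly)"
unfolding nat_of_poly_def
proof (rule f_inv_into_f)
  have "f \<in> polys_below (Suc (degree f))" by (simp add: polys_below_iff)
  then show "f \<in> range nat_poly" by (auto simp: polys_below_eq_nat_poly_image)
qed

lemma nat_of_poly_less:
  "(f :: 'p::prime_card mod_ring poly) \<in> polys_below m \<Longrightarrow> nat_of_poly f < CARD('p) ^ m"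
  by (auto simp: polys_below_eq_nat_poly_image)

lemma mod_in_polys_below: "b \<noteq> 0 \<Longrightarrow> f mod b \<in> polys_below (degree b)" for b :: "'a::field poly"
  using degree_mod_less[of b f] by (auto simp: polys_below_iff)

lemma vdc_int_digit_less:
  "b \<noteq> 0 \<Longrightarrow> nat_of_poly (f mod b) < CARD('p) ^ degree b" for b :: "'p::prime_card mod_ring poly"
  by (intro nat_of_poly_less mod_in_polys_below)

text \<open>The \<open>K\<close> lowest b-adic digits of \<open>f\<close> and the residue of
  \<open>f\<close> modulo \<open>b ^ K\<close> determine each other. The induction assembles \<rho>
  by placing the digit read off from \<open>y mod p^(degree b)\<close> in front of
  \<open>b ^ K\<close>.\<close>

lemma vdc_int_eq_iff_dvd:
  fixes b :: "'p::prime_card mod_ring poly"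
  assumes b: "b \<noteq> 0" and y: "y < (CARD('p) ^ degree b) ^ K"
  shows "\<exists>\<rho>. \<forall>f. vdc_int b f K = y \<longleftrightarrow> b ^ K dvd f - \<rho>"
  using y
proof (induction K arbitrary: y)
  case 0
  then show ?case by simp
next
  case (Suc K)
  let ?q = "CARD('p) ^ degree b"
  have q: "?q > 0" by simp
  have "y div ?q < ?q ^ K" using Suc.prems by (simp add: less_mult_imp_div_less mult.commute)
  from Suc.IH[OF this] obtain \<rho> where \<rho>: "\<And>f. vdc_int b f K = y div ?q \<longleftrightarrow> b ^ K dvd f - \<rho>" by blast
  define \<sigma> where "\<sigma> = (nat_poly (y mod ?q) :: 'p mod_ring poly)"
  have "\<sigma> \<in> polys_below (degree b)" unfolding \<sigma>_def by (rule nat_poly_in_polys_below) simp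
  then have \<sigma>: "\<sigma> mod b = \<sigma>" by (auto simp: polys_below_iff mod_poly_less)
  define \<rho>' where "\<rho>' = b ^ K * \<sigma> + \<rho> mod b ^ K"
  have mod_Suc: "f mod b ^ Suc K = b ^ K * (f div b ^ K mod b) + f mod b ^ K" for f
    using poly_mod_mult_right[of f "b ^ K" b] by (simp add: mult.commute)
  have div\<rho>': "\<rho>' div b ^ K = \<sigma>" using b by (simp add: \<rho>'_def)
  have mod\<rho>': "\<rho>' mod b ^ K = \<rho> mod b ^ K" by (simp add: \<rho>'_def)
  have "vdc_int b f (Suc K) = y \<longleftrightarrow> b ^ Suc K dvd f - \<rho>'" for f
  proof -
    let ?e = "nat_of_poly (f div b ^ K mod b)"
    have e: "?e < ?q" using b by (rule vdc_int_digit_less)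
    have "vdc_int b f (Suc K) = y \<longleftrightarrow> vdc_int b f K = y div ?q \<and> ?e = y mod ?q"
      using e by (auto simp: mult.commute)
    also have "?e = y mod ?q \<longleftrightarrow> f div b ^ K mod b = \<sigma>"
      unfolding \<sigma>_def by (metis nat_of_poly_nat_poly nat_poly_nat_of_poly)
    also have "vdc_int b f K = y div ?q \<longleftrightarrow> f mod b ^ K = \<rho>' mod b ^ K"
      by (simp add: \<rho> mod\<rho>' mod_eq_dvd_iff)
    also have "f mod b ^ K = \<rho>' mod b ^ K \<and> f div b ^ K mod b = \<sigma> \<longleftrightarrow> f mod b ^ Suc K = \<rho>' mod b ^ Suc K"
    proof
      assume "f mod b ^ K = \<rho>' mod b ^ K \<and> f div b ^ K mod b = \<sigma>"
      then show "f mod b ^ Suc K = \<rho>' mod b ^ Suc K" by (simp only: mod_Suc div\<rho>' \<sigma>)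
    next
      assume *: "f mod b ^ Suc K = \<rho>' mod b ^ Suc K"
      have "f mod b ^ K = f mod b ^ Suc K mod b ^ K" by (simp add: mod_mod_cancel)
      also have "\<dots> = \<rho>' mod b ^ K" unfolding * by (simp add: mod_mod_cancel)
      finally have 1: "f mod b ^ K = \<rho>' mod b ^ K" .
      with * have "b ^ K * (f div b ^ K mod b) = b ^ K * \<sigma>" by (simp only: mod_Suc div\<rho>' \<sigma> add_right_cancel)
      then show "f mod b ^ K = \<rho>' mod b ^ K \<and> f div b ^ K mod b = \<sigma>" using 1 b by simp
    qed
    also have "\<dots> \<longleftrightarrow> b ^ Suc K dvd f - \<rho>'" by (rule mod_eq_dvd_iff)
    finally show ?thesis .
  qed
  then show ?case by blast
qed

text \<open>The base-\<open>q\<close> digits of \<open>J\<close> split the interval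
  \<open>[0, J / q^K)\<close> into elementary intervals, at most \<open>q\<close> of each order
  \<open>d\<close>. An elementary interval of order \<open>d\<close> is a residue class modulo
  \<open>b ^ d\<close> and costs \<open>E d\<close>.\<close>

lemma vdc_int_count:
  fixes b :: "'p::prime_card mod_ring poly"
  defines "q \<equiv> CARD('p) ^ degree b"
  assumes b: "b \<noteq> 0" and fin: "finite S" and J: "J \<le> q ^ K"
    and E: "\<And>d \<rho>. d \<le> K \<Longrightarrow> \<bar>real (card {f\<in>S. b ^ d dvd f - \<rho>}) - v / real q ^ d\<bar> \<le> E d"
  shows "\<bar>real (card {f\<in>S. vdc_int b f K < J}) - v * (real J / real q ^ K)\<bar> \<le> (\<Sum>d\<le>K. real q * E d)"
  using J E
proof (induction K arbitrary: J)
  case 0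
  have q: "real q \<ge> 1" by (simp add: q_def Suc_le_eq)
  have E0: "\<bar>real (card S) - v\<bar> \<le> E 0" using 0(2)[of 0 0] by simp
  then have "E 0 \<le> real q * E 0" "0 \<le> real q * E 0" using q mult_right_mono[of 1 "real q" "E 0"] by auto
  moreover have "J = 0 \<or> J = 1" using 0 by auto
  ultimately show ?case using E0 by auto
next
  case (Suc K)
  have q: "q > 0" by (simp add: q_def)
  define J' j where "J' = J div q" and "j = J mod q"
  have J: "J = q * J' + j" by (simp add: J'_def j_def)
  have j: "j < q" using q by (simp add: j_def)
  have J'le: "J' \<le> q ^ K" using div_le_mono[OF Suc.prems(1), of q] q by (simp add: J'_def)
  have digit: "nat_of_poly (f div b ^ K mod b) < q" for f
    unfolding q_def using b by (rule vdc_int_digit_less)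
  have vS: "vdc_int b f (Suc K) = q * vdc_int b f K + nat_of_poly (f div b ^ K mod b)" for f
    by (simp add: q_def)
  \<comment> \<open>Lexicographic comparison: the leading \<open>K\<close> digits lie below
    \<open>J'\<close>, or they agree with \<open>J'\<close> and the last digit is below
    \<open>j\<close>.\<close>
  have less_iff: "vdc_int b f (Suc K) < J \<longleftrightarrow>
      vdc_int b f K < J' \<or> (\<exists>e<j. vdc_int b f (Suc K) = q * J' + e)" for f
  proof -
    define u e where "u = vdc_int b f K" and "e = nat_of_poly (f div b ^ K mod b)"
    have e: "e < q" unfolding e_def by (rule digit)
    have "q * u + e < q * J' + j \<longleftrightarrow> u < J' \<or> (\<exists>e'<j. q * u + e = q * J' + e')"
    proof (cases u J' rule: linorder_cases)
      case less
      then have "q * Suc u \<le> q * J'" by (intro mult_le_mono2) simp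
      then show ?thesis using less e by simp
    next
      case equal
      then show ?thesis by auto
    next
      case greater
      then have "q * Suc J' \<le> q * u" by (intro mult_le_mono2) simp
      then have "q * J' + j < q * u" using j by simp
      then show ?thesis using greater by auto
    qed
    then show ?thesis unfolding vS J u_def e_def .
  qed
  have E1: "\<bar>real (card {f\<in>S. vdc_int b f (Suc K) = q * J' + e}) - v / real q ^ Suc K\<bar> \<le> E (Suc K)"
    if e: "e < j" for e
  proof -
    have "q * J' + e < J" using J e by simp
    with Suc.prems(1) have "q * J' + e < q ^ Suc K" by linarith
    then obtain \<rho> where "\<And>f. vdc_int b f (Suc K) = q * J' + e \<longleftrightarrow> b ^ Suc K dvd f - \<rho>"
      using vdc_int_eq_iff_dvd[OF b, of "q * J' + e" "Suc K"] unfolding q_def by blast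
    then show ?thesis using Suc.prems(2)[of "Suc K" \<rho>] by (simp only: order.refl)
  qed
  have E_pos: "E (Suc K) \<ge> 0" using Suc.prems(2)[of "Suc K" 0] by linarith
  have "{f\<in>S. vdc_int b f (Suc K) < J} = {f\<in>S. vdc_int b f K < J'} \<union>
      (\<Union>e<j. {f\<in>S. vdc_int b f (Suc K) = q * J' + e})"
    using less_iff by blast
  moreover have "{f\<in>S. vdc_int b f K < J'} \<inter> (\<Union>e<j. {f\<in>S. vdc_int b f (Suc K) = q * J' + e}) = {}"
  proof -
    have False if "vdc_int b f K < J'" "vdc_int b f (Suc K) = q * J' + e" for f e
    proof -
      have "q * Suc (vdc_int b f K) \<le> q * J'" using that by (intro mult_le_mono2) simp
      with that(2) digit[of f] show False unfolding vS by simp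
    qed
    then show ?thesis by blast
  qed
  ultimately have "card {f\<in>S. vdc_int b f (Suc K) < J} = card {f\<in>S. vdc_int b f K < J'} +
      card (\<Union>e<j. {f\<in>S. vdc_int b f (Suc K) = q * J' + e})"
    using fin by (simp only:) (intro card_Un_disjoint, auto)
  also have "card (\<Union>e<j. {f\<in>S. vdc_int b f (Suc K) = q * J' + e})
      = (\<Sum>e<j. card {f\<in>S. vdc_int b f (Suc K) = q * J' + e})"
    using fin by (intro card_UN_disjoint) auto
  finally have card_eq: "card {f\<in>S. vdc_int b f (Suc K) < J} = card {f\<in>S. vdc_int b f K < J'} +
      (\<Sum>e<j. card {f\<in>S. vdc_int b f (Suc K) = q * J' + e})" .
  have "v * (real J / real q ^ Suc K) = v * (real J' / real q ^ K) + real j * (v / real q ^ Suc K)"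
    using q by (simp add: J field_simps)
  then have "real (card {f\<in>S. vdc_int b f (Suc K) < J}) - v * (real J / real q ^ Suc K) =
      (real (card {f\<in>S. vdc_int b f K < J'}) - v * (real J' / real q ^ K)) +
      (\<Sum>e<j. real (card {f\<in>S. vdc_int b f (Suc K) = q * J' + e}) - v / real q ^ Suc K)"
    unfolding card_eq by (simp add: sum_subtractf del: vdc_int.simps power_Suc)
  also have "\<bar>\<dots>\<bar> \<le> (\<Sum>d\<le>K. real q * E d) + (\<Sum>e<j. E (Suc K))"
  proof (rule order.trans[OF abs_triangle_ineq add_mono])
    show "\<bar>real (card {f\<in>S. vdc_int b f K < J'}) - v * (real J' / real q ^ K)\<bar> \<le> (\<Sum>d\<le>K. real q * E d)"
      by (rule Suc.IH[OF J'le]) (simp add: Suc.prems(2))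
    show "\<bar>\<Sum>e<j. real (card {f\<in>S. vdc_int b f (Suc K) = q * J' + e}) - v / real q ^ Suc K\<bar> \<le> (\<Sum>e<j. E (Suc K))"
      by (rule order.trans[OF sum_abs sum_mono]) (use E1 in auto)
  qed
  also have "(\<Sum>e<j. E (Suc K)) \<le> real q * E (Suc K)"
    using j E_pos by (auto intro!: mult_right_mono)
  finally show ?case by simp
qed

section \<open>Several coprime bases at once\<close>

lemma chinese_remainder_poly:
  fixes G H :: "'a::field_gcd poly"
  assumes "coprime G H"
  shows "\<exists>\<rho>. \<forall>f. G * H dvd f - \<rho> \<longleftrightarrow> G dvd f - \<rho>1 \<and> H dvd f - \<rho>2"
proof -
  obtain u w where uw: "u * G + w * H = 1"
    using assms bezout_coefficients_fst_snd[of G H] by (metis coprime_imp_gcd_eq_1)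
  define \<rho> where "\<rho> = \<rho>1 + u * G * (\<rho>2 - \<rho>1)"
  have "\<rho> - \<rho>2 = (\<rho>1 - \<rho>2) * (1 - u * G)" by (simp add: \<rho>_def algebra_simps)
  also have "1 - u * G = w * H" using uw by (simp add: algebra_simps)
  finally have H: "H dvd \<rho> - \<rho>2" by simp
  have G: "G dvd \<rho> - \<rho>1" by (simp add: \<rho>_def)
  have "G * H dvd f - \<rho> \<longleftrightarrow> G dvd f - \<rho>1 \<and> H dvd f - \<rho>2" for f
  proof
    assume *: "G * H dvd f - \<rho>"
    have "G dvd (f - \<rho>) + (\<rho> - \<rho>1)" using dvd_mult_left[OF *] G by (rule dvd_add)
    moreover have "H dvd (f - \<rho>) + (\<rho> - \<rho>2)" using dvd_mult_right[OF *] H by (rule dvd_add)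
    ultimately show "G dvd f - \<rho>1 \<and> H dvd f - \<rho>2" by simp
  next
    assume *: "G dvd f - \<rho>1 \<and> H dvd f - \<rho>2"
    have "G dvd (f - \<rho>1) - (\<rho> - \<rho>1)" using * G by (blast intro: dvd_diff)
    moreover have "H dvd (f - \<rho>2) - (\<rho> - \<rho>2)" using * H by (blast intro: dvd_diff)
    ultimately show "G * H dvd f - \<rho>" using assms by (intro divides_mult) simp_all
  qed
  then show ?thesis by blast
qed

text \<open>The weight \<open>p ^ degree b\<close> bounds the number of elementary intervals of each order \<open>d\<close> into which
  an interval \<open>[0, \<beta>)\<close> is split.\<close>
fun modulus_sum :: "nat \<Rightarrow> ('p::prime_card mod_ring poly \<Rightarrow> real) \<Rightarrow> 'p mod_ring poly list \<Rightarrow> 'p mod_ring poly \<Rightarrow> real" where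
  "modulus_sum K \<phi> [] G = \<phi> G"
| "modulus_sum K \<phi> (b # bs) G = (\<Sum>d\<le>K. real (CARD('p) ^ degree b) * modulus_sum K \<phi> bs (G * b ^ d))"

definition vdc_volume :: "nat \<Rightarrow> 'p::prime_card mod_ring poly list \<Rightarrow> nat list \<Rightarrow> real" where
  "vdc_volume K bs Js = (\<Prod>(b, J)\<leftarrow>zip bs Js. real J / real (CARD('p) ^ degree b) ^ K)"

text \<open>Induction on the bases. The interval in the first base is split by
  \<open>vdc_int_count\<close>, applied to the set already cut out by \<open>G\<close> and by the
  remaining bases. The Chinese remainder theorem merges the class modulo \<open>b ^ d\<close> with
  the one modulo \<open>G\<close>, so the induction hypothesis is applied with the modulus
  \<open>G * b ^ d\<close>, which is coprime to the bases left.\<close>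

lemma halton_box_count:
  fixes bs :: "'p::prime_card mod_ring poly list"
  assumes fin: "finite S"
    and base: "\<And>G \<rho>. G \<noteq> 0 \<Longrightarrow> \<bar>real (card {f\<in>S. G dvd f - \<rho>}) - v / real CARD('p) ^ degree G\<bar> \<le> \<phi> G"
    and "sorted_wrt coprime bs" "0 \<notin> set bs" "G \<noteq> 0" "\<forall>b\<in>set bs. coprime G b"
    and "list_all2 (\<lambda>b J. J \<le> (CARD('p) ^ degree b) ^ K) bs Js"
  shows "\<bar>real (card {f\<in>S. G dvd f - \<rho> \<and> list_all2 (\<lambda>b J. vdc_int b f K < J) bs Js})
           - v / real CARD('p) ^ degree G * vdc_volume K bs Js\<bar> \<le> modulus_sum K \<phi> bs G"
  using assms(3-)
proof (induction bs arbitrary: G Js \<rho>)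
  case Nil
  then show ?case using base[of G \<rho>] by (simp add: vdc_volume_def)
next
  case (Cons b bs)
  obtain J Js' where Js: "Js = J # Js'" "J \<le> (CARD('p) ^ degree b) ^ K"
     "list_all2 (\<lambda>b J. J \<le> (CARD('p) ^ degree b) ^ K) bs Js'"
    using Cons.prems(5) by (auto simp: list_all2_Cons1)
  have b: "b \<noteq> 0" using Cons.prems by auto
  let ?S = "{f\<in>S. G dvd f - \<rho> \<and> list_all2 (\<lambda>b J. vdc_int b f K < J) bs Js'}"
  let ?v = "v / real CARD('p) ^ degree G * vdc_volume K bs Js'"
  have "\<bar>real (card {f\<in>?S. b ^ d dvd f - \<sigma>}) - ?v / real (CARD('p) ^ degree b) ^ d\<bar> \<le> modulus_sum K \<phi> bs (G * b ^ d)"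
    for d \<sigma>
  proof -
    have "coprime G (b ^ d)" using Cons.prems by simp
    then obtain \<tau> where \<tau>: "\<And>f. G * b ^ d dvd f - \<tau> \<longleftrightarrow> G dvd f - \<rho> \<and> b ^ d dvd f - \<sigma>"
      using chinese_remainder_poly by metis
    have S_eq: "{f\<in>?S. b ^ d dvd f - \<sigma>} = {f\<in>S. G * b ^ d dvd f - \<tau> \<and> list_all2 (\<lambda>b J. vdc_int b f K < J) bs Js'}"
      using \<tau> by blast
    have "degree (G * b ^ d) = degree G + degree b * d"
      using b Cons.prems(3) by (simp add: degree_mult_eq degree_power_eq mult.commute)
    then have v_eq: "?v / real (CARD('p) ^ degree b) ^ d = v / real CARD('p) ^ degree (G * b ^ d) * vdc_volume K bs Js'"
      by (simp add: power_add power_mult)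
    show ?thesis unfolding S_eq v_eq
      by (rule Cons.IH) (use Cons.prems b Js in auto)
  qed
  from vdc_int_count[OF b _ Js(2) this]
  have "\<bar>real (card {f\<in>?S. vdc_int b f K < J}) - ?v * (real J / real (CARD('p) ^ degree b) ^ K)\<bar>
      \<le> (\<Sum>d\<le>K. real (CARD('p) ^ degree b) * modulus_sum K \<phi> bs (G * b ^ d))"
    using fin by simp
  moreover have "{f\<in>?S. vdc_int b f K < J}
      = {f\<in>S. G dvd f - \<rho> \<and> list_all2 (\<lambda>b J. vdc_int b f K < J) (b # bs) Js}"
    by (auto simp: Js)
  moreover have "?v * (real J / real (CARD('p) ^ degree b) ^ K) = v / real CARD('p) ^ degree G * vdc_volume K (b # bs) Js"
    by (simp add: Js vdc_volume_def)
  ultimately show ?case by simp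
qed

section \<open>Initial segments of the integers as unions of blocks\<close>

lemma card_Collect_less_add:
  fixes A B :: nat
  shows "card {l. l < A + B \<and> P l} = card {l. l < A \<and> P l} + card {l. l < B \<and> P (A + l)}"
proof -
  have "{l. l < A + B \<and> P l} = {l. l < A \<and> P l} \<union> (+) A ` {l. l < B \<and> P (A + l)}" (is "?L = ?R")
  proof
    show "?L \<subseteq> ?R"
    proof
      fix l assume l: "l \<in> ?L"
      show "l \<in> ?R"
      proof (cases "l < A")
        case False
        then have "l = A + (l - A)" by simp
        then show ?thesis using l False by (intro UnI2 image_eqI[of _ _ "l - A"]) auto
      qed (use l in auto)
    qed
  qed auto
  also have "card \<dots> = card {l. l < A \<and> P l} + card ((+) A ` {l. l < B \<and> P (A + l)})"
    by (rule card_Un_disjoint) auto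
  also have "card ((+) A ` {l. l < B \<and> P (A + l)}) = card {l. l < B \<and> P (A + l)}"
    by (rule card_image) simp
  finally show ?thesis .
qed

text \<open>The base-p digits of \<open>N\<close> cut the range into fewer than \<open>p\<close>
  blocks of each length \<open>p^r\<close>, every block starting at a multiple of its length. The
  offset \<open>M\<close> is carried along because the remainder of the range begins at such a
  multiple and not at 0.\<close>

lemma digit_block_count:
  fixes P :: "nat \<Rightarrow> bool" and p :: nat
  assumes p: "p > 1"
    and E: "\<And>r M. r < R \<Longrightarrow> \<bar>real (card {l. l < p ^ r \<and> P (M * p ^ r + l)}) - real p ^ r * v\<bar> \<le> E r"
    and N: "N < p ^ R"
  shows "\<bar>real (card {l. l < N \<and> P (M * p ^ R + l)}) - real N * v\<bar> \<le> (\<Sum>r<R. real p * E r)"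
  using E N
proof (induction R arbitrary: N M)
  case (Suc R)
  let ?P = "\<lambda>l. P (M * p ^ Suc R + l)"
  define c N' where "c = N div p ^ R" and "N' = N mod p ^ R"
  have N: "N = c * p ^ R + N'" unfolding c_def N'_def by (rule div_mult_mod_eq[symmetric])
  have c: "c < p" using Suc.prems(2) by (simp add: c_def less_mult_imp_div_less)
  have N': "N' < p ^ R" using p by (simp add: N'_def)
  have shift: "M * p ^ Suc R + (k * p ^ R + l) = (M * p + k) * p ^ R + l" for k l
    by (simp add: algebra_simps)
  have E_R: "\<bar>real (card {l. l < p ^ R \<and> P (m * p ^ R + l)}) - real p ^ R * v\<bar> \<le> E R" for m
    by (rule Suc.prems(1)) simp
  then have E_pos: "E R \<ge> 0" by (meson abs_ge_zero order.trans)
  have full: "\<bar>real (card {l. l < k * p ^ R \<and> ?P l}) - real (k * p ^ R) * v\<bar> \<le> real k * E R" for k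
  proof (induction k)
    case (Suc k)
    have Suc_k: "Suc k * p ^ R = k * p ^ R + p ^ R" by simp
    have "card {l. l < Suc k * p ^ R \<and> ?P l}
        = card {l. l < k * p ^ R \<and> ?P l} + card {l. l < p ^ R \<and> P ((M * p + k) * p ^ R + l)}"
      unfolding Suc_k card_Collect_less_add by (simp only: shift)
    then show ?case using Suc E_R[of "M * p + k"]
      by (simp add: algebra_simps abs_le_iff)
  qed simp
  have "card {l. l < N \<and> ?P l} = card {l. l < c * p ^ R \<and> ?P l} + card {l. l < N' \<and> P ((M * p + c) * p ^ R + l)}"
    unfolding N card_Collect_less_add by (simp only: shift)
  moreover have "\<bar>real (card {l. l < N' \<and> P ((M * p + c) * p ^ R + l)}) - real N' * v\<bar> \<le> (\<Sum>r<R. real p * E r)"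
    by (rule Suc.IH[OF _ N']) (simp add: Suc.prems(1))
  moreover have "real N * v = real (c * p ^ R) * v + real N' * v" by (simp add: N algebra_simps)
  moreover have "real c * E R \<le> real p * E R" using c E_pos by (intro mult_right_mono) auto
  ultimately show ?case using full[of c] by (simp add: abs_le_iff)
qed simp

subsection \<open>A discrepancy bound for fixed L\<close>

lemma eval_at_p_eq_nat_of_poly: "eval_at_p (f :: 'p::prime_card mod_ring poly) = real (nat_of_poly f)"
  by (metis eval_at_p_nat_poly nat_poly_nat_of_poly)

lemma nat_of_poly_0 [simp]: "nat_of_poly (0 :: 'p::prime_card mod_ring poly) = 0"
  using nat_of_poly_nat_poly[of 0, where 'p='p] by simp

lemma vdc_int_eq_sum:
  fixes b :: "'p::prime_card mod_ring poly"
  shows "real (vdc_int b f K) / real (CARD('p) ^ degree b) ^ K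
    = (\<Sum>i<K. real (nat_of_poly (f div b ^ i mod b)) / real (CARD('p) ^ degree b) ^ Suc i)"
proof (induction K)
  case (Suc K)
  let ?q = "real (CARD('p) ^ degree b)"
  have q: "?q > 0" by simp
  have "real (vdc_int b f (Suc K)) / ?q ^ Suc K
      = real (vdc_int b f K) / ?q ^ K + real (nat_of_poly (f div b ^ K mod b)) / ?q ^ Suc K"
    using q by (simp add: add_divide_distrib)
  then show ?case using Suc.IH by simp
qed simp

text \<open>Since \<open>b ^ i\<close> has degree at least \<open>i\<close>, the b-adic digits of
  \<open>nat_poly n\<close> from position \<open>R\<close> on vanish. The van der Corput point is
  therefore an exact multiple of \<open>p^(- R * degree b)\<close>.\<close>

lemma vdc_poly_eq_vdc_int:
  fixes b :: "'p::prime_card mod_ring poly"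
  assumes b: "degree b \<ge> 1" and n: "n < CARD('p) ^ R" and R: "R \<ge> 1"
  shows "vdc_poly b n = real (vdc_int b (nat_poly n) R) / real (CARD('p) ^ degree b) ^ R"
proof -
  let ?f = "nat_poly n :: 'p mod_ring poly"
  have deg: "degree ?f < R"
    using nat_poly_in_polys_below[OF n] R by (auto simp: polys_below_iff)
  have zero: "?f div b ^ i = 0" if "degree ?f < i" for i
  proof (rule div_poly_less)
    have "b \<noteq> 0" using b by auto
    then have "degree (b ^ i) = i * degree b" by (simp add: degree_power_eq)
    also have "\<dots> \<ge> i" using b by simp
    finally show "degree ?f < degree (b ^ i)" using that by linarith
  qed
  have "vdc_poly b n = (\<Sum>i\<le>degree ?f. real (nat_of_poly (?f div b ^ i mod b)) / real (CARD('p) ^ degree b) ^ Suc i)"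
    by (simp add: vdc_poly_def eval_at_p_eq_nat_of_poly power_mult power_add)
  also have "\<dots> = (\<Sum>i<R. real (nat_of_poly (?f div b ^ i mod b)) / real (CARD('p) ^ degree b) ^ Suc i)"
    using deg zero by (intro sum.mono_neutral_left) auto
  also have "\<dots> = real (vdc_int b ?f R) / real (CARD('p) ^ degree b) ^ R"
    by (rule vdc_int_eq_sum[symmetric])
  finally show ?thesis .
qed

definition discr_bound :: "real \<Rightarrow> nat \<Rightarrow> 'p::prime_card mod_ring poly list \<Rightarrow> (nat \<Rightarrow> 'p mod_ring) \<Rightarrow> real" where
  "discr_bound \<theta> R bs a =
     (\<Sum>r<R. real CARD('p) * modulus_sum R (\<lambda>G. approx_sum \<theta> a (r - degree G) G) bs 1)"

text \<open>On a block the indices run through a coset \<open>C + polys_below r\<close>, where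
  \<open>kron_val_count_residue_class\<close> supplies the estimate for every modulus that
  \<open>halton_box_count\<close> asks for. The recursion starts from the modulus 1, which imposes
  no congruence, and the blocks are put together by \<open>digit_block_count\<close>.\<close>

lemma hybrid_digit_box_count:
  fixes bs :: "'p::prime_card mod_ring poly list" and a :: "nat \<Rightarrow> 'p mod_ring"
  assumes bs: "sorted_wrt coprime bs" "0 \<notin> set bs"
    and Js: "list_all2 (\<lambda>b J. J \<le> (CARD('p) ^ degree b) ^ R) bs Js"
    and \<beta>: "0 \<le> \<beta>" "\<beta> \<le> 1" and N: "N < CARD('p) ^ R"
  shows "\<bar>real (card {n. n < N \<and> kron_val a (nat_poly n) < \<beta> \<and> list_all2 (\<lambda>b J. vdc_int b (nat_poly n) R < J) bs Js})
           - real N * (\<beta> * vdc_volume R bs Js)\<bar> \<le> discr_bound 1 R bs a"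
proof -
  let ?p = "CARD('p)"
  define P where "P n \<longleftrightarrow> kron_val a (nat_poly n) < \<beta> \<and> list_all2 (\<lambda>b J. vdc_int b (nat_poly n) R < J) bs Js" for n
  have "\<bar>real (card {l. l < ?p ^ r \<and> P (M * ?p ^ r + l)}) - real ?p ^ r * (\<beta> * vdc_volume R bs Js)\<bar>
      \<le> modulus_sum R (\<lambda>G. approx_sum 1 a (r - degree G) G) bs 1" for r M
  proof -
    define C where "C = (nat_poly (M * ?p ^ r) :: 'p mod_ring poly)"
    define S where "S = {f. f - C \<in> polys_below r \<and> kron_val a f < \<beta>}"
    have block: "(\<lambda>l. nat_poly (M * ?p ^ r + l)) ` {..<?p ^ r} = {f. f - C \<in> polys_below r}" (is "?L = ?R")
    proof (intro equalityI subsetI)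
      fix f assume "f \<in> ?L"
      then show "f \<in> ?R" by (auto simp: nat_poly_block C_def nat_poly_in_polys_below)
    next
      fix f assume "f \<in> ?R"
      then obtain l where "l < ?p ^ r" "f - C = nat_poly l" by (auto simp: polys_below_eq_nat_poly_image)
      moreover from this have "f = C + nat_poly l" by (simp add: diff_eq_eq add.commute)
      ultimately show "f \<in> ?L" by (intro image_eqI[of _ _ l]) (auto simp: nat_poly_block C_def)
    qed
    have inj: "inj_on (\<lambda>l. nat_poly (M * ?p ^ r + l) :: 'p mod_ring poly) A" for A
      by (intro inj_onI) (use inj_nat_poly[where 'p='p] in \<open>auto dest: injD\<close>)
    have "finite {f. f - C \<in> polys_below r}" unfolding block[symmetric] by simp
    then have fin: "finite S" by (rule rev_finite_subset) (auto simp: S_def)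
    have "\<bar>real (card {f\<in>S. G dvd f - \<rho>}) - real ?p ^ r * \<beta> / real ?p ^ degree G\<bar> \<le> approx_sum 1 a (r - degree G) G"
      if "G \<noteq> 0" for G \<rho>
    proof -
      have "{f\<in>S. G dvd f - \<rho>} = {f. f - C \<in> polys_below r \<and> G dvd f - \<rho> \<and> kron_val a f < \<beta>}"
        by (auto simp: S_def)
      then show ?thesis using kron_val_count_residue_class[OF that \<beta>, of C r \<rho> a] by simp
    qed
    from halton_box_count[OF fin this bs(1,2), of 1 R Js 0] Js
    have "\<bar>real (card {f\<in>S. list_all2 (\<lambda>b J. vdc_int b f R < J) bs Js}) - real ?p ^ r * \<beta> * vdc_volume R bs Js\<bar>
        \<le> modulus_sum R (\<lambda>G. approx_sum 1 a (r - degree G) G) bs 1"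
      by simp
    moreover have "{f\<in>S. list_all2 (\<lambda>b J. vdc_int b f R < J) bs Js}
        = (\<lambda>l. nat_poly (M * ?p ^ r + l)) ` {l. l < ?p ^ r \<and> P (M * ?p ^ r + l)}" (is "?A = ?B")
    proof (intro equalityI subsetI)
      fix f assume f: "f \<in> ?A"
      then have "f \<in> (\<lambda>l. nat_poly (M * ?p ^ r + l)) ` {..<?p ^ r}" unfolding block by (simp add: S_def)
      then show "f \<in> ?B" using f by (auto simp: S_def P_def)
    next
      fix f assume f: "f \<in> ?B"
      then have "f \<in> {f. f - C \<in> polys_below r}" unfolding block[symmetric] by auto
      then show "f \<in> ?A" using f by (auto simp: S_def P_def)
    qed
    ultimately show ?thesis by (simp add: card_image[OF inj] mult.assoc)
  qed
  from digit_block_count[OF card_p_gt_1 this N, of 0]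
  show ?thesis by (simp add: P_def discr_bound_def)
qed

text \<open>Rounding the van der Corput sides of a box up to multiples of \<open>1 / q i\<close>
  does not change the count, because the points are such multiples themselves. The volume changes by
  at most \<open>1 / N\<close> per side, since \<open>q i \<ge> p^R > N\<close>; this is the origin
  of the summand \<open>length bs\<close>.\<close>

lemma star_discrepancy_le_discr_bound:
  fixes bs :: "'p::prime_card mod_ring poly list" and a :: "nat \<Rightarrow> 'p mod_ring"
  assumes bs: "sorted_wrt coprime bs" "\<forall>b\<in>set bs. degree b \<ge> 1"
    and N: "1 \<le> N" "N < CARD('p) ^ R" and R: "R \<ge> 1"
  shows "real N * star_discrepancy (hybrid_point a bs) (1 + length bs) N \<le> real (length bs) + discr_bound 1 R bs a"
proof -
  let ?p = "CARD('p)" and ?t = "length bs"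
  have bs0: "0 \<notin> set bs" using bs(2) by force
  have main: "\<bar>real (count_box (hybrid_point a bs) (1 + ?t) N \<beta>) / real N - (\<Prod>i<1 + ?t. \<beta> i)\<bar>
      \<le> (real ?t + discr_bound 1 R bs a) / real N"
    if \<beta>: "\<forall>i<1 + ?t. 0 \<le> \<beta> i \<and> \<beta> i \<le> 1" for \<beta>
  proof -
    define q where "q i = real (?p ^ degree (bs ! i)) ^ R" for i
    define J where "J i = nat \<lceil>\<beta> (Suc i) * q i\<rceil>" for i
    define Js where "Js = map J [0..<?t]"
    have q: "q i > 0" for i by (simp add: q_def)
    have \<beta>S: "0 \<le> \<beta> (Suc i)" "\<beta> (Suc i) \<le> 1" if "i < ?t" for i using \<beta> that by auto
    have J_le: "J i \<le> (?p ^ degree (bs ! i)) ^ R" if "i < ?t" for i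
    proof -
      have "\<beta> (Suc i) * q i \<le> q i" using \<beta>S[OF that] q[of i] by (simp add: mult_left_le_one_le)
      also have "q i = real_of_int (int ((?p ^ degree (bs ! i)) ^ R))" by (simp add: q_def)
      finally show ?thesis unfolding J_def nat_le_iff ceiling_le_iff .
    qed
    have vdc_iff: "vdc_poly (bs ! i) n < \<beta> (Suc i) \<longleftrightarrow> vdc_int (bs ! i) (nat_poly n) R < J i"
      if "i < ?t" "n < N" for i n
    proof -
      have "vdc_poly (bs ! i) n = real (vdc_int (bs ! i) (nat_poly n) R) / q i"
        unfolding q_def using that N R bs(2) by (intro vdc_poly_eq_vdc_int) auto
      then have "vdc_poly (bs ! i) n < \<beta> (Suc i) \<longleftrightarrow> real_of_int (int (vdc_int (bs ! i) (nat_poly n) R)) < \<beta> (Suc i) * q i"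
        using q[of i] by (simp add: divide_less_eq)
      also have "\<dots> \<longleftrightarrow> vdc_int (bs ! i) (nat_poly n) R < J i"
        unfolding J_def less_ceiling_iff[symmetric] by (simp add: zless_nat_eq_int_zless)
      finally show ?thesis .
    qed
    have count: "count_box (hybrid_point a bs) (1 + ?t) N \<beta>
        = card {n. n < N \<and> kron_val a (nat_poly n) < \<beta> 0 \<and> list_all2 (\<lambda>b J. vdc_int b (nat_poly n) R < J) bs Js}"
      unfolding count_box_def
      by (rule arg_cong[where f = card])
         (auto simp: All_less_Suc2 hybrid_point_def kronecker_eq_kron_val vdc_iff list_all2_conv_all_nth Js_def)
    have le1: "\<bar>real (count_box (hybrid_point a bs) (1 + ?t) N \<beta>) - real N * (\<beta> 0 * vdc_volume R bs Js)\<bar> \<le> discr_bound 1 R bs a"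
      unfolding count using \<beta> N J_le
      by (intro hybrid_digit_box_count bs bs0) (auto simp: list_all2_conv_all_nth Js_def)
    have vol: "vdc_volume R bs Js = (\<Prod>i<?t. real (J i) / q i)"
      by (simp add: vdc_volume_def prod.list_conv_set_nth Js_def q_def atLeast0LessThan)
    have Jq: "\<bar>real (J i) / q i - \<beta> (Suc i)\<bar> \<le> 1 / real N" if i: "i < ?t" for i
    proof -
      have "real (J i) = of_int \<lceil>\<beta> (Suc i) * q i\<rceil>" using \<beta>S[OF i] q[of i] by (simp add: J_def)
      then have "\<bar>real (J i) - \<beta> (Suc i) * q i\<bar> \<le> 1" by linarith
      then have "\<bar>(real (J i) - \<beta> (Suc i) * q i) / q i\<bar> \<le> 1 / q i"
        using q[of i] by (simp add: abs_divide divide_right_mono)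
      also have "(real (J i) - \<beta> (Suc i) * q i) / q i = real (J i) / q i - \<beta> (Suc i)"
        using q[of i] by (simp add: diff_divide_distrib)
      also have "1 / q i \<le> 1 / real N"
      proof -
        have "real N \<le> real (?p ^ R)" using N by simp
        also have "\<dots> \<le> q i"
          unfolding q_def of_nat_power using bs(2) i
          by (intro power_mono self_le_power) (auto simp: Suc_le_eq)
        finally show ?thesis using N q[of i] by (intro divide_left_mono) auto
      qed
      finally show ?thesis .
    qed
    \<comment> \<open>All factors lie in \<open>[0, 1]\<close>, so replacing them one at a time
      bounds the difference of the products by the sum of the differences.\<close>
    have "\<bar>(\<Prod>i<?t. real (J i) / q i) - (\<Prod>i<?t. \<beta> (Suc i))\<bar> \<le> (\<Sum>i<?t. \<bar>real (J i) / q i - \<beta> (Suc i)\<bar>)"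
    proof -
      have "real (J i) / q i \<le> 1" if "i < ?t" for i
      proof -
        have "real (J i) \<le> real ((?p ^ degree (bs ! i)) ^ R)" using J_le[OF that] by (simp only: of_nat_le_iff)
        then show ?thesis using q[of i] by (simp add: q_def)
      qed
      then show ?thesis
        using norm_prod_diff[of "{..<?t}" "\<lambda>i. real (J i) / q i" "\<lambda>i. \<beta> (Suc i)"] \<beta>S q
        by (simp add: less_imp_le abs_of_nonneg)
    qed
    also have "\<dots> \<le> (\<Sum>i<?t. 1 / real N)" using Jq by (intro sum_mono) auto
    finally have "\<bar>vdc_volume R bs Js - (\<Prod>i<?t. \<beta> (Suc i))\<bar> \<le> real ?t / real N" by (simp add: vol)
    then have "\<bar>\<beta> 0\<bar> * \<bar>vdc_volume R bs Js - (\<Prod>i<?t. \<beta> (Suc i))\<bar> \<le> 1 * (real ?t / real N)"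
      using \<beta> by (intro mult_mono) auto
    then have "\<bar>\<beta> 0 * vdc_volume R bs Js - (\<Prod>i<1 + ?t. \<beta> i)\<bar> \<le> real ?t / real N"
      unfolding plus_1_eq_Suc prod.lessThan_Suc_shift by (simp add: abs_mult[symmetric] right_diff_distrib)
    moreover have "\<bar>real (count_box (hybrid_point a bs) (1 + ?t) N \<beta>) / real N - \<beta> 0 * vdc_volume R bs Js\<bar>
        \<le> discr_bound 1 R bs a / real N"
    proof -
      have "real (count_box (hybrid_point a bs) (1 + ?t) N \<beta>) / real N - \<beta> 0 * vdc_volume R bs Js
          = (real (count_box (hybrid_point a bs) (1 + ?t) N \<beta>) - real N * (\<beta> 0 * vdc_volume R bs Js)) / real N"
        using N by (simp add: diff_divide_distrib)
      then show ?thesis using le1 N by (simp add: abs_divide divide_right_mono)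
    qed
    ultimately show ?thesis unfolding add_divide_distrib by linarith
  qed
  have "star_discrepancy (hybrid_point a bs) (1 + ?t) N \<le> (real ?t + discr_bound 1 R bs a) / real N"
    unfolding star_discrepancy_def
  proof (rule cSUP_least)
    show "{\<beta>::nat \<Rightarrow> real. \<forall>i<1 + ?t. 0 \<le> \<beta> i \<and> \<beta> i \<le> 1} \<noteq> {}"
      by (auto intro!: exI[of _ "\<lambda>_. 0"])
  qed (use main in blast)
  then show ?thesis using N by (simp add: field_simps)
qed

subsection \<open>Measure estimates\<close>

lemma product_prob_space_haar_H:
  "product_prob_space (\<lambda>_::nat. uniform_count_measure (UNIV :: 'p::prime_card mod_ring set))"
  by (intro product_prob_spaceI prob_space_uniform_count_measure) auto

lemma prob_space_haar_H: "prob_space (haar_H :: (nat \<Rightarrow> 'p::prime_card mod_ring) measure)"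
  unfolding haar_H_def by (intro prob_space_PiM prob_space_uniform_count_measure) auto

lemma haar_H_cylinder:
  fixes c :: "nat \<Rightarrow> 'p::prime_card mod_ring"
  assumes J: "finite J"
  shows "{a. \<forall>j\<in>J. a j = c j} \<in> sets haar_H"
    and "emeasure haar_H {a. \<forall>j\<in>J. a j = c j} = ennreal (1 / real CARD('p) ^ card J)"
proof -
  let ?M = "\<lambda>_::nat. uniform_count_measure (UNIV :: 'p mod_ring set)"
  interpret product_prob_space ?M UNIV by (rule product_prob_space_haar_H)
  have eq: "{a. \<forall>j\<in>J. a j = c j} = prod_emb UNIV ?M J (Pi\<^sub>E J (\<lambda>j. {c j}))"
    using J by (auto simp: prod_emb_def space_uniform_count_measure PiE_iff extensional_def)
  show "{a. \<forall>j\<in>J. a j = c j} \<in> sets haar_H"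
    unfolding eq haar_H_def by (rule sets_PiM_I) (use J in \<open>auto simp: sets_uniform_count_measure\<close>)
  have "emeasure haar_H {a. \<forall>j\<in>J. a j = c j} = (\<Prod>j\<in>J. emeasure (?M j) {c j})"
    unfolding eq haar_H_def by (rule emeasure_PiM_emb) (use J in \<open>auto simp: sets_uniform_count_measure\<close>)
  also have "\<dots> = ennreal (1 / real CARD('p) ^ card J)"
    by (simp add: emeasure_uniform_count_measure ennreal_power power_one_over)
  finally show "emeasure haar_H {a. \<forall>j\<in>J. a j = c j} = ennreal (1 / real CARD('p) ^ card J)" .
qed

text \<open>The set is a union of cylinders over the first \<open>n\<close> coordinates, each of
  measure \<open>p^(-n)\<close>. Its elements are determined on these by the first \<open>d\<close>
  coordinates, so at most \<open>p^d\<close> cylinders occur.\<close>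

lemma haar_H_finitely_determined:
  fixes A :: "(nat \<Rightarrow> 'p::prime_card mod_ring) set"
  assumes dep: "\<And>a b. (\<forall>j<n. a j = b j) \<Longrightarrow> a \<in> A \<Longrightarrow> b \<in> A"
    and det: "\<And>a b j. a \<in> A \<Longrightarrow> b \<in> A \<Longrightarrow> (\<forall>j<d. a j = b j) \<Longrightarrow> j < n \<Longrightarrow> a j = b j"
    and dn: "d \<le> n"
  shows "A \<in> sets haar_H" and "emeasure haar_H A \<le> ennreal (real CARD('p) ^ d / real CARD('p) ^ n)"
proof -
  define C where "C = (\<lambda>a. restrict a {..<n}) ` A"
  define cyl where "cyl c = {a::nat \<Rightarrow> 'p mod_ring. \<forall>j\<in>{..<n}. a j = c j}" for c
  have "C \<subseteq> PiE {..<n} (\<lambda>_. UNIV)" by (auto simp: C_def split: if_splits)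
  moreover have "finite (PiE {..<n} (\<lambda>_. UNIV :: 'p mod_ring set))" by (intro finite_PiE) auto
  ultimately have finC: "finite C" by (rule finite_subset)
  have A: "A = (\<Union>c\<in>C. cyl c)"
  proof (intro equalityI subsetI)
    fix b assume "b \<in> (\<Union>c\<in>C. cyl c)"
    then obtain a where "a \<in> A" "\<forall>j<n. a j = b j" by (auto simp: C_def cyl_def)
    then show "b \<in> A" using dep by blast
  qed (auto simp: C_def cyl_def)
  have "inj_on (\<lambda>c. restrict c {..<d}) C"
  proof (rule inj_onI)
    fix c c' assume *: "c \<in> C" "c' \<in> C" "restrict c {..<d} = restrict c' {..<d}"
    then obtain a b where ab: "a \<in> A" "b \<in> A" "c = restrict a {..<n}" "c' = restrict b {..<n}"
      by (auto simp: C_def)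
    have "a j = b j" if "j < d" for j
      using fun_cong[OF *(3), of j] that dn ab by simp
    then have "a j = b j" if "j < n" for j using det[OF ab(1,2)] that by blast
    then show "c = c'" unfolding ab by (auto simp: restrict_def)
  qed
  then have "card C = card ((\<lambda>c. restrict c {..<d}) ` C)" by (simp add: card_image)
  also have "\<dots> \<le> card (PiE {..<d} (\<lambda>_. UNIV :: 'p mod_ring set))"
    by (intro card_mono finite_PiE) (auto split: if_splits)
  also have "\<dots> = CARD('p) ^ d" by (simp add: card_PiE)
  finally have cardC: "card C \<le> CARD('p) ^ d" .
  have cyl: "cyl c \<in> sets haar_H" "emeasure haar_H (cyl c) = ennreal (1 / real CARD('p) ^ n)" for c
    unfolding cyl_def using haar_H_cylinder[of "{..<n}" c] by auto
  show "A \<in> sets haar_H" unfolding A using finC cyl by (intro sets.finite_UN) auto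
  have "emeasure haar_H A \<le> (\<Sum>c\<in>C. emeasure haar_H (cyl c))"
    unfolding A using finC cyl by (intro emeasure_subadditive_finite) auto
  also have "\<dots> = ennreal (real (card C) * (1 / real CARD('p) ^ n))"
    by (simp add: cyl ennreal_of_nat_eq_real_of_nat flip: ennreal_mult)
  also have "\<dots> \<le> ennreal (real CARD('p) ^ d / real CARD('p) ^ n)"
  proof (rule ennreal_leI)
    have "real (card C) \<le> real CARD('p) ^ d" using cardC by (metis of_nat_le_iff of_nat_power)
    then show "real (card C) * (1 / real CARD('p) ^ n) \<le> real CARD('p) ^ d / real CARD('p) ^ n"
      by (simp add: divide_right_mono)
  qed
  finally show "emeasure haar_H A \<le> ennreal (real CARD('p) ^ d / real CARD('p) ^ n)" .
qed

text \<open>The conditions are a linear recurrence whose solutions are determined by \<open>degree g\<close> initial values.\<close>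
lemma haar_H_frac_coeff_zero:
  fixes g :: "'p::prime_card mod_ring poly"
  assumes g: "g \<noteq> 0"
  shows "{a. \<forall>j<m. frac_coeff a g j = 0} \<in> sets haar_H"
    and "emeasure haar_H {a. \<forall>j<m. frac_coeff a g j = 0} \<le> ennreal (1 / real CARD('p) ^ m)"
proof -
  let ?A = "{a. \<forall>j<m. frac_coeff a g j = 0}"
  let ?D = "degree g"
  have dep: "b \<in> ?A" if "\<forall>j<m + ?D. a j = b j" "a \<in> ?A" for a b
  proof -
    have "frac_coeff a g j = frac_coeff b g j" if "j < m" for j
      unfolding frac_coeff_def using that \<open>\<forall>j<m + ?D. a j = b j\<close> by (intro sum.cong) auto
    then show ?thesis using that by auto
  qed
  have det: "a j = b j" if ab: "a \<in> ?A" "b \<in> ?A" "\<forall>j<?D. a j = b j" and "j < m + ?D" for a b j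
    using that(4)
  proof (induction j rule: less_induct)
    case (less j)
    show ?case
    proof (cases "j < ?D")
      case False
      define i where "i = j - ?D"
      have j: "j = i + ?D" and i: "i < m" using False less.prems by (auto simp: i_def)
      have split: "frac_coeff c g i = (\<Sum>l<?D. Polynomial.coeff g l * c (i + l)) + lead_coeff g * c j" for c
        by (simp add: frac_coeff_def j lessThan_Suc_atMost[symmetric])
      have "(\<Sum>l<?D. Polynomial.coeff g l * a (i + l)) = (\<Sum>l<?D. Polynomial.coeff g l * b (i + l))"
        using less.IH less.prems j by (intro sum.cong) auto
      moreover have "frac_coeff a g i = frac_coeff b g i" using ab i by auto
      ultimately have "lead_coeff g * a j = lead_coeff g * b j" unfolding split by (simp only: add_left_cancel)
      then show ?thesis using g by simp
    qed (use ab in auto)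
  qed
  show "?A \<in> sets haar_H"
    by (rule haar_H_finitely_determined[of "m + ?D" ?A ?D]) (fact dep det le_add2)+
  have "emeasure haar_H ?A \<le> ennreal (real CARD('p) ^ ?D / real CARD('p) ^ (m + ?D))"
    by (rule haar_H_finitely_determined[of "m + ?D" ?A ?D]) (fact dep det le_add2)+
  then show "emeasure haar_H ?A \<le> ennreal (1 / real CARD('p) ^ m)" by (simp add: power_add)
qed

section \<open>Expected size of the counting error\<close>

lemma sum_power_diff_le:
  fixes x :: real
  assumes "0 \<le> x" "x < 1"
  shows "(\<Sum>j<m. x ^ (m - j)) \<le> x / (1 - x)"
proof (induction m)
  case (Suc m)
  have "(\<Sum>j<Suc m. x ^ (Suc m - j)) = x * (\<Sum>j<m. x ^ (m - j)) + x"
    by (simp add: sum_distrib_left Suc_diff_le)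
  also have "\<dots> \<le> x * (x / (1 - x)) + x" using Suc assms by (intro add_mono mult_left_mono) auto
  also have "\<dots> = x / (1 - x)" using assms by (simp add: field_simps)
  finally show ?case .
qed (use assms in simp)

definition approx_const :: "'p::prime_card itself \<Rightarrow> real \<Rightarrow> real" where
  "approx_const _ \<theta> = 1 + real CARD('p) * (real CARD('p) powr (\<theta> - 1) / (1 - real CARD('p) powr (\<theta> - 1)))"

text \<open>The event belonging to \<open>f\<close> has probability at most \<open>p^(-m)\<close>,
  because \<open>f * G\<close> is nonzero. At most \<open>p^(j + 1)\<close> polynomials have degree
  \<open>j\<close>, so together they contribute at most \<open>p * x^(m - j)\<close> with
  \<open>x = p^(\<theta> - 1)\<close>, a geometric series bounded independently of \<open>m\<close>
  and \<open>G\<close>. For \<open>\<theta> = 1\<close> this estimate would only give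
  \<open>p * m\<close>, which costs one more logarithm.\<close>

lemma nn_integral_approx_sum:
  fixes G :: "'p::prime_card mod_ring poly"
  assumes G: "G \<noteq> 0" and \<theta>: "\<theta> < 1"
  shows "(\<lambda>a. ennreal (approx_sum \<theta> a m G)) \<in> borel_measurable haar_H"
    and "(\<integral>\<^sup>+a. ennreal (approx_sum \<theta> a m G) \<partial>haar_H) \<le> ennreal (approx_const TYPE('p) \<theta>)"
proof -
  let ?p = "real CARD('p)"
  interpret prob_space "haar_H :: (nat \<Rightarrow> 'p mod_ring) measure" by (rule prob_space_haar_H)
  have p: "?p > 1" using card_p_gt_1[where 'p='p] by linarith
  define F where "F = (polys_below m - {0} :: 'p mod_ring poly set)"
  define A where "A f = {a. \<forall>j<m. frac_coeff a (f * G) j = 0}" for f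
  define w where "w f = ?p powr (\<theta> * real (m - degree f))" for f :: "'p mod_ring poly"
  have finF: "finite F" by (simp add: F_def)
  have A: "A f \<in> sets haar_H" "emeasure haar_H (A f) \<le> ennreal (1 / ?p ^ m)" if "f \<in> F" for f
    using that G unfolding A_def by (auto simp: F_def intro!: haar_H_frac_coeff_zero)
  have eq: "ennreal (approx_sum \<theta> a m G) = 1 + (\<Sum>f\<in>F. ennreal (w f) * indicator (A f) a)" for a
  proof -
    have "approx_sum \<theta> a m G = 1 + (\<Sum>f\<in>F. w f * indicator (A f) a)"
      unfolding approx_sum_def F_def[symmetric]
      by (intro arg_cong2[where f = "(+)"] refl sum.cong) (auto simp: w_def A_def indicator_def)
    also have "ennreal \<dots> = 1 + ennreal (\<Sum>f\<in>F. w f * indicator (A f) a)"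
      by (subst ennreal_plus) (auto simp: w_def intro!: sum_nonneg)
    also have "ennreal (\<Sum>f\<in>F. w f * indicator (A f) a) = (\<Sum>f\<in>F. ennreal (w f * indicator (A f) a))"
      by (rule sum_ennreal[symmetric]) (auto simp: w_def)
    also have "\<dots> = (\<Sum>f\<in>F. ennreal (w f) * indicator (A f) a)"
      by (intro sum.cong refl) (auto simp: indicator_def)
    finally show ?thesis .
  qed
  have meas: "(\<lambda>a. ennreal (w f) * indicator (A f) a) \<in> borel_measurable haar_H" if "f \<in> F" for f
    using A(1)[OF that] by simp
  show "(\<lambda>a. ennreal (approx_sum \<theta> a m G)) \<in> borel_measurable haar_H"
    unfolding eq using meas by (intro borel_measurable_add borel_measurable_sum) auto
  have "(\<integral>\<^sup>+a. ennreal (approx_sum \<theta> a m G) \<partial>haar_H)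
      = (\<integral>\<^sup>+a. 1 \<partial>(haar_H :: (nat \<Rightarrow> 'p mod_ring) measure)) + (\<Sum>f\<in>F. \<integral>\<^sup>+a. ennreal (w f) * indicator (A f) a \<partial>haar_H)"
    unfolding eq using meas by (simp add: nn_integral_add nn_integral_sum)
  also have "(\<integral>\<^sup>+a. 1 \<partial>(haar_H :: (nat \<Rightarrow> 'p mod_ring) measure)) = 1"
    using emeasure_space_1 by simp
  also have "(\<Sum>f\<in>F. \<integral>\<^sup>+a. ennreal (w f) * indicator (A f) a \<partial>haar_H) = (\<Sum>f\<in>F. ennreal (w f) * emeasure haar_H (A f))"
    using A by (intro sum.cong refl nn_integral_cmult_indicator) auto
  also have "\<dots> \<le> (\<Sum>f\<in>F. ennreal (w f) * ennreal (1 / ?p ^ m))"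
    using A by (intro sum_mono mult_left_mono) auto
  also have "\<dots> = ennreal (\<Sum>f\<in>F. w f * (1 / ?p ^ m))"
  proof -
    have "ennreal (w f) * ennreal (1 / ?p ^ m) = ennreal (w f * (1 / ?p ^ m))" for f
      by (rule ennreal_mult[symmetric]) (auto simp: w_def)
    then show ?thesis by (simp only:) (rule sum_ennreal, simp add: w_def)
  qed
  also have "1 + \<dots> = ennreal (1 + (\<Sum>f\<in>F. w f * (1 / ?p ^ m)))"
    by (subst ennreal_plus) (auto simp: w_def intro!: sum_nonneg)
  also have "\<dots> \<le> ennreal (approx_const TYPE('p) \<theta>)"
  proof (rule ennreal_leI)
    define x where "x = ?p powr (\<theta> - 1)"
    have x: "0 \<le> x" "x < 1" using p \<theta> by (auto simp: x_def powr_less_one)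
    have "(\<Sum>f\<in>F. w f * (1 / ?p ^ m)) = (\<Sum>j<m. \<Sum>f | f \<in> F \<and> degree f = j. w f * (1 / ?p ^ m))"
      using finF by (intro sum.group[symmetric]) (auto simp: F_def polys_below_iff)
    also have "\<dots> \<le> (\<Sum>j<m. ?p * x ^ (m - j))"
    proof (rule sum_mono)
      fix j assume j: "j \<in> {..<m}"
      have "card {f. f \<in> F \<and> degree f = j} \<le> card (polys_below (Suc j) :: 'p mod_ring poly set)"
        by (intro card_mono) (auto simp: polys_below_iff)
      then have card: "real (card {f. f \<in> F \<and> degree f = j}) \<le> ?p ^ Suc j"
        unfolding card_polys_below by (metis of_nat_le_iff of_nat_power)
      have "(\<Sum>f | f \<in> F \<and> degree f = j. w f * (1 / ?p ^ m))
          = real (card {f. f \<in> F \<and> degree f = j}) * (?p powr (\<theta> * real (m - j)) * (1 / ?p ^ m))"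
        by (simp add: w_def)
      also have "\<dots> \<le> ?p ^ Suc j * (?p powr (\<theta> * real (m - j)) * (1 / ?p ^ m))"
        using card by (intro mult_right_mono) auto
      also have "\<dots> = ?p * x ^ (m - j)"
      proof -
        have "?p ^ m = ?p ^ j * ?p ^ (m - j)" using j by (simp flip: power_add)
        moreover have "x ^ (m - j) = ?p powr (\<theta> * real (m - j)) / ?p ^ (m - j)"
        proof -
          have "x ^ (m - j) = x powr real (m - j)" using p by (simp add: x_def powr_realpow)
          also have "\<dots> = ?p powr (\<theta> * real (m - j) - real (m - j))"
            unfolding x_def powr_powr by (simp add: left_diff_distrib)
          also have "\<dots> = ?p powr (\<theta> * real (m - j)) / ?p ^ (m - j)"
            using p by (simp add: powr_diff powr_realpow)
          finally show ?thesis .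
        qed
        ultimately show ?thesis using p by simp
      qed
      finally show "(\<Sum>f | f \<in> F \<and> degree f = j. w f * (1 / ?p ^ m)) \<le> ?p * x ^ (m - j)" .
    qed
    also have "\<dots> = ?p * (\<Sum>j<m. x ^ (m - j))" by (simp add: sum_distrib_left)
    also have "\<dots> \<le> ?p * (x / (1 - x))" using sum_power_diff_le[OF x] by (intro mult_left_mono) auto
    finally show "1 + (\<Sum>f\<in>F. w f * (1 / ?p ^ m)) \<le> approx_const TYPE('p) \<theta>"
      by (simp add: approx_const_def x_def)
  qed
  finally show "(\<integral>\<^sup>+a. ennreal (approx_sum \<theta> a m G) \<partial>haar_H) \<le> ennreal (approx_const TYPE('p) \<theta>)"
    by (simp add: add_left_mono)
qed

lemma approx_const_nonneg: "\<theta> < 1 \<Longrightarrow> approx_const TYPE('p::prime_card) \<theta> \<ge> 0"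
proof -
  assume \<theta>: "\<theta> < 1"
  have "real CARD('p) > 1" using card_p_gt_1[where 'p='p] by linarith
  then have "real CARD('p) powr (\<theta> - 1) < 1" using \<theta> by (simp add: powr_less_one)
  then show ?thesis by (simp add: approx_const_def)
qed

lemma modulus_sum_nonneg:
  assumes "\<And>G. \<phi> G \<ge> 0"
  shows "modulus_sum K \<phi> bs G \<ge> 0"
  by (induction bs arbitrary: G) (auto intro!: sum_nonneg mult_nonneg_nonneg simp: assms)

lemma nn_integral_modulus_sum:
  fixes bs :: "'p::prime_card mod_ring poly list"
  assumes \<phi>: "\<And>a G. \<phi> a G \<ge> 0"
    and meas: "\<And>G. G \<noteq> 0 \<Longrightarrow> (\<lambda>a. ennreal (\<phi> a G)) \<in> borel_measurable M"
    and int: "\<And>G. G \<noteq> 0 \<Longrightarrow> (\<integral>\<^sup>+a. ennreal (\<phi> a G) \<partial>M) \<le> ennreal C"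
    and C: "C \<ge> 0" and "0 \<notin> set bs" "G \<noteq> 0"
  shows "(\<lambda>a. ennreal (modulus_sum K (\<phi> a) bs G)) \<in> borel_measurable M"
    and "(\<integral>\<^sup>+a. ennreal (modulus_sum K (\<phi> a) bs G) \<partial>M)
      \<le> ennreal (real (K + 1) ^ length bs * real (\<Prod>b\<leftarrow>bs. CARD('p) ^ degree b) * C)"
proof -
  have "(\<lambda>a. ennreal (modulus_sum K (\<phi> a) bs G)) \<in> borel_measurable M \<and>
    (\<integral>\<^sup>+a. ennreal (modulus_sum K (\<phi> a) bs G) \<partial>M)
      \<le> ennreal (real (K + 1) ^ length bs * real (\<Prod>b\<leftarrow>bs. CARD('p) ^ degree b) * C)"
    using assms(5,6)
  proof (induction bs arbitrary: G)
    case Nil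
    then show ?case using meas int by simp
  next
    case (Cons b bs)
    let ?q = "real (CARD('p) ^ degree b)"
    let ?B = "real (K + 1) ^ length bs * real (\<Prod>b\<leftarrow>bs. CARD('p) ^ degree b) * C"
    have B: "?B \<ge> 0" using C by simp
    have qB: "0 \<le> ?q * ?B" by (rule mult_nonneg_nonneg[OF of_nat_0_le_iff B])
    have eq: "ennreal (modulus_sum K (\<phi> a) (b # bs) G) = (\<Sum>d\<le>K. ennreal ?q * ennreal (modulus_sum K (\<phi> a) bs (G * b ^ d)))" for a
      using \<phi> by (simp add: sum_ennreal[symmetric] modulus_sum_nonneg ennreal_mult)
    have G: "G * b ^ d \<noteq> 0" for d using Cons.prems by auto
    have IH: "(\<lambda>a. ennreal (modulus_sum K (\<phi> a) bs (G * b ^ d))) \<in> borel_measurable M"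
       "(\<integral>\<^sup>+a. ennreal (modulus_sum K (\<phi> a) bs (G * b ^ d)) \<partial>M) \<le> ennreal ?B" for d
      using Cons.IH[OF _ G] Cons.prems by auto
    have "(\<integral>\<^sup>+a. ennreal (modulus_sum K (\<phi> a) (b # bs) G) \<partial>M)
        = (\<Sum>d\<le>K. ennreal ?q * (\<integral>\<^sup>+a. ennreal (modulus_sum K (\<phi> a) bs (G * b ^ d)) \<partial>M))"
      unfolding eq using IH(1) by (simp add: nn_integral_sum nn_integral_cmult)
    also have "\<dots> \<le> (\<Sum>d\<le>K. ennreal ?q * ennreal ?B)"
      using IH(2) by (intro sum_mono mult_left_mono) auto
    also have "\<dots> = (\<Sum>d\<le>K. ennreal (?q * ?B))" using B by (simp only: ennreal_mult of_nat_0_le_iff)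
    also have "\<dots> = ennreal (\<Sum>d\<le>K. ?q * ?B)" by (rule sum_ennreal) (rule qB)
    also have "(\<Sum>d\<le>K. ?q * ?B) = real (K + 1) ^ length (b # bs) * real (\<Prod>b\<leftarrow>b # bs. CARD('p) ^ degree b) * C"
      by (simp add: algebra_simps)
    finally have "(\<integral>\<^sup>+a. ennreal (modulus_sum K (\<phi> a) (b # bs) G) \<partial>M)
      \<le> ennreal (real (K + 1) ^ length (b # bs) * real (\<Prod>b\<leftarrow>b # bs. CARD('p) ^ degree b) * C)" .
    moreover have "(\<lambda>a. ennreal (modulus_sum K (\<phi> a) (b # bs) G)) \<in> borel_measurable M"
      unfolding eq using IH(1) by simp
    ultimately show ?case by blast
  qed
  then show "(\<lambda>a. ennreal (modulus_sum K (\<phi> a) bs G)) \<in> borel_measurable M"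
    "(\<integral>\<^sup>+a. ennreal (modulus_sum K (\<phi> a) bs G) \<partial>M)
      \<le> ennreal (real (K + 1) ^ length bs * real (\<Prod>b\<leftarrow>bs. CARD('p) ^ degree b) * C)" by auto
qed

lemma approx_sum_nonneg: "approx_sum \<theta> a m G \<ge> 0"
  using approx_sum_ge_1[of \<theta> a m G] by linarith

lemma discr_bound_nonneg: "discr_bound \<theta> R bs a \<ge> 0"
  unfolding discr_bound_def
  by (intro sum_nonneg mult_nonneg_nonneg modulus_sum_nonneg approx_sum_nonneg) auto

text \<open>As the expectation of \<open>approx_sum\<close> is bounded uniformly in \<open>r\<close>
  and \<open>G\<close>, only the number of terms matters: \<open>R\<close> block lengths and
  \<open>R + 1\<close> exponents for each base.\<close>

lemma nn_integral_discr_bound: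
  fixes bs :: "'p::prime_card mod_ring poly list"
  assumes \<theta>: "\<theta> < 1" and bs: "0 \<notin> set bs"
  shows "(\<lambda>a. ennreal (discr_bound \<theta> R bs a)) \<in> borel_measurable haar_H"
    and "(\<integral>\<^sup>+a. ennreal (discr_bound \<theta> R bs a) \<partial>haar_H)
      \<le> ennreal (real R * (real CARD('p) * (real (R + 1) ^ length bs * real (\<Prod>b\<leftarrow>bs. CARD('p) ^ degree b) * approx_const TYPE('p) \<theta>)))"
proof -
  let ?B = "real (R + 1) ^ length bs * real (\<Prod>b\<leftarrow>bs. CARD('p) ^ degree b) * approx_const TYPE('p) \<theta>"
  let ?S = "\<lambda>r a. modulus_sum R (\<lambda>G. approx_sum \<theta> a (r - degree G) G) bs 1"
  have B: "?B \<ge> 0" using approx_const_nonneg[OF \<theta>, where 'p='p] by simp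
  have S: "(\<lambda>a. ennreal (?S r a)) \<in> borel_measurable haar_H" "(\<integral>\<^sup>+a. ennreal (?S r a) \<partial>haar_H) \<le> ennreal ?B" for r
    using bs nn_integral_modulus_sum[where \<phi> = "\<lambda>a G. approx_sum \<theta> a (r - degree G) G"
        and C = "approx_const TYPE('p) \<theta>" and M = "haar_H :: (nat \<Rightarrow> 'p mod_ring) measure" and bs = bs and G = 1 and K = R,
        OF approx_sum_nonneg nn_integral_approx_sum[OF _ \<theta>] approx_const_nonneg[OF \<theta>]]
    by auto
  have eq: "ennreal (discr_bound \<theta> R bs a) = (\<Sum>r<R. ennreal (real CARD('p)) * ennreal (?S r a))" for a
    unfolding discr_bound_def
    by (simp add: sum_ennreal[symmetric] modulus_sum_nonneg approx_sum_nonneg ennreal_mult)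
  show "(\<lambda>a. ennreal (discr_bound \<theta> R bs a)) \<in> borel_measurable haar_H"
    unfolding eq using S(1) by simp
  have "(\<integral>\<^sup>+a. ennreal (discr_bound \<theta> R bs a) \<partial>haar_H) = (\<Sum>r<R. ennreal (real CARD('p)) * (\<integral>\<^sup>+a. ennreal (?S r a) \<partial>haar_H))"
    unfolding eq using S(1) by (simp add: nn_integral_sum nn_integral_cmult)
  also have "\<dots> \<le> (\<Sum>r<R. ennreal (real CARD('p)) * ennreal ?B)"
    using S(2) by (intro sum_mono mult_left_mono) auto
  also have "\<dots> = (\<Sum>r<R. ennreal (real CARD('p) * ?B))" using B by (simp only: ennreal_mult of_nat_0_le_iff)
  also have "\<dots> = ennreal (\<Sum>r<R. real CARD('p) * ?B)"
    by (rule sum_ennreal) (rule mult_nonneg_nonneg[OF of_nat_0_le_iff B])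
  also have "(\<Sum>r<R. real CARD('p) * ?B) = real R * (real CARD('p) * ?B)" by simp
  finally show "(\<integral>\<^sup>+a. ennreal (discr_bound \<theta> R bs a) \<partial>haar_H) \<le> ennreal (real R * (real CARD('p) * ?B))" .
qed

subsection \<open>Passing to a concave power\<close>

text \<open>After division by \<open>x + y\<close> this follows from
  \<open>z \<le> z powr \<theta>\<close> on \<open>[0, 1]\<close>.\<close>

lemma powr_add_le:
  fixes x y \<theta> :: real
  assumes "0 \<le> x" "0 \<le> y" "0 < \<theta>" "\<theta> \<le> 1"
  shows "(x + y) powr \<theta> \<le> x powr \<theta> + y powr \<theta>"
proof (cases "x + y = 0")
  case True
  then show ?thesis using assms by simp
next
  case False
  define s where "s = x + y"
  have s: "s > 0" using False assms by (simp add: s_def)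
  have *: "z / s \<le> (z / s) powr \<theta>" if "0 \<le> z" "z \<le> s" for z
    using powr_mono'[of \<theta> 1 "z / s"] that s assms by (cases "z = 0") simp_all
  have "1 = x / s + y / s" using s by (simp add: s_def add_divide_distrib[symmetric])
  also have "\<dots> \<le> (x / s) powr \<theta> + (y / s) powr \<theta>"
    using assms by (intro add_mono *) (auto simp: s_def)
  also have "\<dots> = (x powr \<theta> + y powr \<theta>) / s powr \<theta>"
    using s assms by (simp add: powr_divide add_divide_distrib)
  finally show ?thesis using s by (simp add: s_def pos_le_divide_eq)
qed

lemma powr_sum_le:
  fixes f :: "'a \<Rightarrow> real"
  assumes "\<And>i. i \<in> A \<Longrightarrow> f i \<ge> 0" "0 < \<theta>" "\<theta> \<le> 1"
  shows "(\<Sum>i\<in>A. f i) powr \<theta> \<le> (\<Sum>i\<in>A. f i powr \<theta>)"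
  using assms(1)
proof (induction A rule: infinite_finite_induct)
  case (insert i A)
  have "(f i + sum f A) powr \<theta> \<le> f i powr \<theta> + sum f A powr \<theta>"
    using insert.prems assms by (intro powr_add_le sum_nonneg) auto
  then show ?case using insert by simp
qed (use assms in auto)

lemma approx_sum_powr_le:
  fixes G :: "'p::prime_card mod_ring poly"
  assumes "0 < \<theta>" "\<theta> \<le> 1"
  shows "approx_sum 1 a m G powr \<theta> \<le> approx_sum \<theta> a m G"
proof -
  define w where "w \<theta> f = (if \<forall>j<m. frac_coeff a (f * G) j = 0 then real CARD('p) powr (\<theta> * real (m - degree f)) else 0)" for \<theta> f
  have w: "w 1 f powr \<theta> = w \<theta> f" for f
    using assms by (auto simp: w_def powr_powr mult.commute)
  have eq: "approx_sum \<theta> a m G = 1 + (\<Sum>f\<in>polys_below m - {0}. w \<theta> f)" for \<theta>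
    by (simp add: approx_sum_def w_def)
  have w0: "w 1 f \<ge> 0" for f by (simp add: w_def)
  have "approx_sum 1 a m G powr \<theta> \<le> 1 powr \<theta> + (\<Sum>f\<in>polys_below m - {0}. w 1 f) powr \<theta>"
    unfolding eq using assms w0 by (intro powr_add_le sum_nonneg) auto
  also have "\<dots> \<le> 1 powr \<theta> + (\<Sum>f\<in>polys_below m - {0}. w 1 f powr \<theta>)"
    using assms w0 by (intro add_left_mono powr_sum_le) auto
  also have "\<dots> = approx_sum \<theta> a m G" unfolding w eq by simp
  finally show ?thesis .
qed

text \<open>A weight \<open>q \<ge> 1\<close> satisfies \<open>q powr \<theta> \<le> q\<close>, so
  the weights in \<open>modulus_sum\<close> and \<open>discr_bound\<close> can be left as they are
  when the error terms are raised to a power.\<close>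

lemma mult_powr_le:
  fixes q x \<theta> :: real
  assumes "q \<ge> 1" "x \<ge> 0" "\<theta> \<le> 1" "x powr \<theta> \<le> y"
  shows "(q * x) powr \<theta> \<le> q * y"
proof -
  have "q powr \<theta> \<le> q powr 1" using assms by (intro powr_mono) auto
  then have "q powr \<theta> * x powr \<theta> \<le> q * y" using assms by (intro mult_mono) auto
  then show ?thesis using assms by (simp add: powr_mult)
qed

lemma modulus_sum_powr_le:
  fixes bs :: "'p::prime_card mod_ring poly list"
  assumes \<phi>: "\<And>G. \<phi> G \<ge> 0" "\<And>G. \<phi> G powr \<theta> \<le> \<psi> G" and \<theta>: "0 < \<theta>" "\<theta> \<le> 1"
  shows "modulus_sum K \<phi> bs G powr \<theta> \<le> modulus_sum K \<psi> bs G"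
proof (induction bs arbitrary: G)
  case (Cons b bs)
  let ?q = "real (CARD('p) ^ degree b)"
  have q: "?q \<ge> 1" by (simp add: Suc_le_eq)
  have "modulus_sum K \<phi> (b # bs) G powr \<theta> \<le> (\<Sum>d\<le>K. (?q * modulus_sum K \<phi> bs (G * b ^ d)) powr \<theta>)"
    unfolding modulus_sum.simps using \<theta> \<phi>(1) by (intro powr_sum_le mult_nonneg_nonneg modulus_sum_nonneg) auto
  also have "\<dots> \<le> (\<Sum>d\<le>K. ?q * modulus_sum K \<psi> bs (G * b ^ d))"
    using \<theta> \<phi>(1) Cons.IH q by (intro sum_mono mult_powr_le modulus_sum_nonneg) auto
  finally show ?case by simp
qed (use \<phi> in simp)

lemma discr_bound_powr_le:
  fixes bs :: "'p::prime_card mod_ring poly list"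
  assumes \<theta>: "0 < \<theta>" "\<theta> \<le> 1"
  shows "discr_bound 1 R bs a powr \<theta> \<le> discr_bound \<theta> R bs a"
proof -
  let ?S = "\<lambda>\<theta> r. modulus_sum R (\<lambda>G. approx_sum \<theta> a (r - degree G) G) bs 1"
  have p: "real CARD('p) \<ge> 1" using card_p_gt_1[where 'p='p] by linarith
  have "discr_bound 1 R bs a powr \<theta> \<le> (\<Sum>r<R. (real CARD('p) * ?S 1 r) powr \<theta>)"
    unfolding discr_bound_def using \<theta>
    by (intro powr_sum_le mult_nonneg_nonneg modulus_sum_nonneg approx_sum_nonneg) auto
  also have "\<dots> \<le> (\<Sum>r<R. real CARD('p) * ?S \<theta> r)"
    using \<theta> p by (intro sum_mono mult_powr_le modulus_sum_powr_le modulus_sum_nonneg approx_sum_nonneg approx_sum_powr_le) auto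
  finally show ?thesis by (simp add: discr_bound_def)
qed

subsection \<open>The almost sure bound\<close>

text \<open>With the weights \<open>R powr - (s + \<delta>)\<close> at \<open>R = 2^k\<close>, the
  expectations are summable as a geometric series of ratio \<open>2 powr - \<delta>\<close>. The
  weighted series is thus finite almost everywhere, and its value bounds each of its terms. Using
  only powers of 2 is what allows an arbitrarily small loss \<delta> in the exponent.\<close>

lemma AE_bounded_along_powers_of_2:
  fixes D :: "nat \<Rightarrow> 'a \<Rightarrow> real"
  assumes D: "\<And>R a. D R a \<ge> 0" and meas: "\<And>R. (\<lambda>a. ennreal (D R a)) \<in> borel_measurable M"
    and int: "\<And>R. R \<ge> 1 \<Longrightarrow> (\<integral>\<^sup>+a. ennreal (D R a) \<partial>M) \<le> ennreal (A * real R powr s)"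
    and A: "A \<ge> 0" and \<delta>: "\<delta> > 0"
  shows "AE a in M. \<exists>C. \<forall>k. D (2 ^ k) a \<le> C * real (2 ^ k) powr (s + \<delta>)"
proof -
  define w where "w k = real (2 ^ k) powr - (s + \<delta>)" for k :: nat
  define x where "x = 2 powr - \<delta>"
  have x: "0 \<le> x" "x < 1" using \<delta> by (auto simp: x_def powr_less_one)
  have w: "w k > 0" for k by (simp add: w_def)
  define Z where "Z a = (\<Sum>k. ennreal (w k) * ennreal (D (2 ^ k) a))" for a
  have meas': "(\<lambda>a. ennreal (w k) * ennreal (D (2 ^ k) a)) \<in> borel_measurable M" for k
    using meas by simp
  have "(\<integral>\<^sup>+a. Z a \<partial>M) = (\<Sum>k. \<integral>\<^sup>+a. ennreal (w k) * ennreal (D (2 ^ k) a) \<partial>M)"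
    unfolding Z_def using meas' by (rule nn_integral_suminf)
  also have "\<dots> \<le> (\<Sum>k. ennreal (A * x ^ k))"
  proof (intro suminf_le)
    fix k
    have "(\<integral>\<^sup>+a. ennreal (w k) * ennreal (D (2 ^ k) a) \<partial>M) = ennreal (w k) * (\<integral>\<^sup>+a. ennreal (D (2 ^ k) a) \<partial>M)"
      using meas by (rule nn_integral_cmult)
    also have "\<dots> \<le> ennreal (w k) * ennreal (A * real (2 ^ k) powr s)"
      using int[of "2 ^ k"] by (intro mult_left_mono) auto
    also have "\<dots> = ennreal (w k * (A * real (2 ^ k) powr s))"
      using w[of k] A by (intro ennreal_mult[symmetric]) (auto simp: less_imp_le)
    also have "w k * (A * real (2 ^ k) powr s) = A * x ^ k"
    proof -
      have "w k * real (2 ^ k) powr s = real (2 ^ k) powr - \<delta>"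
        unfolding w_def powr_add[symmetric] by simp
      also have "\<dots> = x ^ k"
        by (simp add: x_def powr_realpow[symmetric] powr_powr mult.commute)
      finally show ?thesis by (simp add: mult_ac)
    qed
    finally show "(\<integral>\<^sup>+a. ennreal (w k) * ennreal (D (2 ^ k) a) \<partial>M) \<le> ennreal (A * x ^ k)" .
  qed auto
  also have "\<dots> = ennreal (\<Sum>k. A * x ^ k)"
    using x A by (intro suminf_ennreal2 summable_mult summable_geometric) auto
  finally have "(\<integral>\<^sup>+a. Z a \<partial>M) \<noteq> \<infinity>" by (auto simp: top_unique)
  moreover have "Z \<in> borel_measurable M" unfolding Z_def using meas' by (rule borel_measurable_suminf_order)
  ultimately have "AE a in M. Z a \<noteq> \<infinity>" by (intro nn_integral_PInf_AE)
  then show ?thesis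
  proof eventually_elim
    fix a assume Z: "Z a \<noteq> \<infinity>"
    have "D (2 ^ k) a \<le> enn2real (Z a) * real (2 ^ k) powr (s + \<delta>)" for k
    proof -
      have "(\<Sum>i\<in>{k}. ennreal (w i) * ennreal (D (2 ^ i) a)) \<le> Z a"
        unfolding Z_def by (rule sum_le_suminf) auto
      then have "ennreal (w k * D (2 ^ k) a) \<le> ennreal (enn2real (Z a))"
        using Z w[of k] D by (simp add: ennreal_mult less_imp_le less_top)
      then have "w k * D (2 ^ k) a \<le> enn2real (Z a)" by (simp add: ennreal_le_iff)
      then have "w k * D (2 ^ k) a * real (2 ^ k) powr (s + \<delta>) \<le> enn2real (Z a) * real (2 ^ k) powr (s + \<delta>)"
        by (rule mult_right_mono) simp
      moreover have "w k * real (2 ^ k) powr (s + \<delta>) = 1"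
        unfolding w_def powr_add[symmetric] by simp
      ultimately show ?thesis by (metis mult.assoc mult.commute mult_1)
    qed
    then show "\<exists>C. \<forall>k. D (2 ^ k) a \<le> C * real (2 ^ k) powr (s + \<delta>)" by blast
  qed
qed

lemma AE_discr_bound:
  fixes bs :: "'p::prime_card mod_ring poly list"
  assumes bs: "0 \<notin> set bs" and \<epsilon>: "\<epsilon> > 0"
  shows "AE a in haar_H. \<exists>C. \<forall>k. discr_bound 1 (2 ^ k) bs a \<le> C * real (2 ^ k) powr (real (length bs) + 1 + \<epsilon>)"
proof -
  define s where "s = real (length bs) + 1"
  have s: "s > 0" by (simp add: s_def)
  define \<theta> where "\<theta> = (s + \<epsilon> / 2) / (s + \<epsilon>)"
  have \<theta>: "0 < \<theta>" "\<theta> < 1" using s \<epsilon> by (auto simp: \<theta>_def)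
  define B where "B = real CARD('p) * (real (\<Prod>b\<leftarrow>bs. CARD('p) ^ degree b) * approx_const TYPE('p) \<theta>)"
  have B: "B \<ge> 0" using approx_const_nonneg[OF \<theta>(2), where 'p='p] by (simp add: B_def)
  have int: "(\<integral>\<^sup>+a. ennreal (discr_bound \<theta> R bs a) \<partial>haar_H) \<le> ennreal (2 ^ length bs * B * real R powr s)" if R: "R \<ge> 1" for R
  proof -
    have "(\<integral>\<^sup>+a. ennreal (discr_bound \<theta> R bs a) \<partial>haar_H) \<le> ennreal (real R * real (R + 1) ^ length bs * B)"
      using nn_integral_discr_bound(2)[OF \<theta>(2) bs, of R] by (simp add: B_def mult_ac)
    also have "\<dots> \<le> ennreal (2 ^ length bs * B * real R powr s)"
    proof (rule ennreal_leI)
      have "real (R + 1) ^ length bs \<le> (2 * real R) ^ length bs" using R by (intro power_mono) auto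
      then have "real R * real (R + 1) ^ length bs * B \<le> real R * (2 * real R) ^ length bs * B"
        using B by (intro mult_right_mono mult_left_mono) auto
      also have "\<dots> = 2 ^ length bs * B * real R ^ (length bs + 1)" by (simp add: power_mult_distrib)
      finally have "real R * real (R + 1) ^ length bs * B \<le> 2 ^ length bs * B * real R ^ (length bs + 1)" .
      moreover have "real R ^ (length bs + 1) = real R powr s"
      proof -
        have "s = real (length bs + 1)" by (simp add: s_def)
        then show ?thesis using R by (simp only:) (rule powr_realpow[symmetric], simp)
      qed
      ultimately show "real R * real (R + 1) ^ length bs * B \<le> 2 ^ length bs * B * real R powr s" by simp
    qed
    finally show ?thesis .
  qed
  have "AE a in haar_H. \<exists>C. \<forall>k. discr_bound \<theta> (2 ^ k) bs a \<le> C * real (2 ^ k) powr (s + \<epsilon> / 2)"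
    by (rule AE_bounded_along_powers_of_2[OF discr_bound_nonneg nn_integral_discr_bound(1)[OF \<theta>(2) bs] int])
       (use B \<epsilon> in auto)
  then show ?thesis
  proof eventually_elim
    fix a assume "\<exists>C. \<forall>k. discr_bound \<theta> (2 ^ k) bs a \<le> C * real (2 ^ k) powr (s + \<epsilon> / 2)"
    then obtain C where C: "\<And>k. discr_bound \<theta> (2 ^ k) bs a \<le> C * real (2 ^ k) powr (s + \<epsilon> / 2)" by blast
    have C0: "C \<ge> 0" using order.trans[OF discr_bound_nonneg C[of 0]] by simp
    have "discr_bound 1 (2 ^ k) bs a \<le> C powr (1 / \<theta>) * real (2 ^ k) powr (s + \<epsilon>)" for k
    proof -
      have "discr_bound 1 (2 ^ k) bs a powr \<theta> \<le> C * real (2 ^ k) powr (s + \<epsilon> / 2)"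
        using discr_bound_powr_le[of \<theta> "2 ^ k" bs a] C[of k] \<theta> by linarith
      then have "(discr_bound 1 (2 ^ k) bs a powr \<theta>) powr (1 / \<theta>) \<le> (C * real (2 ^ k) powr (s + \<epsilon> / 2)) powr (1 / \<theta>)"
        using \<theta> by (intro powr_mono2) auto
      moreover have "(discr_bound 1 (2 ^ k) bs a powr \<theta>) powr (1 / \<theta>) = discr_bound 1 (2 ^ k) bs a"
        using \<theta> discr_bound_nonneg[of 1 "2 ^ k" bs a] by (simp add: powr_powr)
      moreover have "(C * real (2 ^ k) powr (s + \<epsilon> / 2)) powr (1 / \<theta>) = C powr (1 / \<theta>) * real (2 ^ k) powr (s + \<epsilon>)"
      proof -
        have "(s + \<epsilon> / 2) * (1 / \<theta>) = s + \<epsilon>" using s \<epsilon> by (simp add: \<theta>_def)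
        then show ?thesis using C0 by (simp add: powr_mult powr_powr)
      qed
      ultimately show ?thesis by simp
    qed
    then show "\<exists>C. \<forall>k. discr_bound 1 (2 ^ k) bs a \<le> C * real (2 ^ k) powr (real (length bs) + 1 + \<epsilon>)"
      unfolding s_def by blast
  qed
qed

text \<open>The least \<open>k\<close> with \<open>N < p^(2^k)\<close> works: by minimality
  \<open>p^(2^(k - 1)) \<le> N\<close>, so \<open>2^k\<close> exceeds the logarithm of
  \<open>N\<close> at most by a constant factor. For \<open>k = 0\<close> the bound rests on
  \<open>N \<ge> 2\<close>.\<close>

lemma power_of_2_scale:
  fixes p N :: nat
  assumes "p \<ge> 2" "N \<ge> 2"
  obtains k where "N < p ^ (2 ^ k)" "real (2 ^ k) \<le> 2 / ln 2 * ln (real N)"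
proof -
  define k where "k = (LEAST k. N < p ^ (2 ^ k))"
  have "N < p ^ (2 ^ N)"
  proof -
    have "N < 2 ^ N" by (rule less_exp)
    also have "(2::nat) ^ N < 2 ^ (2 ^ N)" using less_exp[of N] by (intro power_strict_increasing) auto
    also have "(2::nat) ^ (2 ^ N) \<le> p ^ (2 ^ N)" using assms by (intro power_mono) auto
    finally show ?thesis .
  qed
  then have N: "N < p ^ (2 ^ k)" unfolding k_def by (rule LeastI)
  have lnN: "ln (real N) \<ge> ln 2" using assms by simp
  have "real (2 ^ k) \<le> 2 / ln 2 * ln (real N)"
  proof (cases k)
    case 0
    have "1 * ln 2 \<le> 2 * ln (real N)" using lnN ln_gt_zero[of "2::real"] by linarith
    then show ?thesis using 0 by (simp add: field_simps)
  next
    case (Suc i)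
    have "\<not> N < p ^ (2 ^ i)" using Suc unfolding k_def by (intro not_less_Least) simp
    then have "p ^ (2 ^ i) \<le> N" by simp
    then have "real (p ^ (2 ^ i)) \<le> real N" by (simp only: of_nat_le_iff)
    moreover have "2 ^ (2 ^ i) \<le> real (p ^ (2 ^ i))" using assms by (simp add: power_mono)
    ultimately have "2 ^ (2 ^ i) \<le> real N" by linarith
    then have "ln (2 ^ (2 ^ i)) \<le> ln (real N)" using assms by (intro ln_mono) auto
    then have "2 ^ i * ln 2 \<le> ln (real N)" by (simp add: ln_realpow)
    then show ?thesis using Suc by (simp add: field_simps)
  qed
  with N show ?thesis by (rule that)
qed

lemma star_discrepancy_growth:
  fixes bs :: "'p::prime_card mod_ring poly list"
  assumes bs: "sorted_wrt coprime bs" "\<forall>b\<in>set bs. degree b \<ge> 1"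
    and C: "\<And>k. discr_bound 1 (2 ^ k) bs a \<le> C * real (2 ^ k) powr \<tau>" and \<tau>: "\<tau> > 0"
  shows "\<exists>c>0. \<forall>N\<ge>2. real N * star_discrepancy (hybrid_point a bs) (1 + length bs) N \<le> c * ln (real N) powr \<tau>"
proof (intro exI conjI allI impI)
  let ?t = "real (length bs)"
  have C0: "C \<ge> 0" using order.trans[OF discr_bound_nonneg C[of 0]] by simp
  \<comment> \<open>Here \<open>?t\<close> comes from rounding the boxes, \<open>C\<close> from
    \<open>discr_bound\<close>, and 1 ensures positivity; the power of \<open>2 / ln 2\<close>
    converts \<open>2 ^ k\<close> into \<open>ln N\<close>.\<close>
  show "(?t + C + 1) * (2 / ln 2) powr \<tau> > 0" using C0 by (simp add: add_nonneg_pos)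
  fix N :: nat assume N: "N \<ge> 2"
  have p: "CARD('p) \<ge> 2" using card_p_gt_1[where 'p='p] by simp
  obtain k where k: "N < CARD('p) ^ (2 ^ k)" "real (2 ^ k) \<le> 2 / ln 2 * ln (real N)"
    using power_of_2_scale[OF p N] .
  let ?R = "real (2 ^ k) powr \<tau>"
  have R: "?R \<ge> 1" using \<tau> by (intro ge_one_powr_ge_zero) auto
  have "real N * star_discrepancy (hybrid_point a bs) (1 + length bs) N \<le> ?t + discr_bound 1 (2 ^ k) bs a"
    using N k by (intro star_discrepancy_le_discr_bound bs) auto
  also have "\<dots> \<le> ?t * ?R + C * ?R" using C[of k] R mult_left_mono[OF R, of ?t] by simp
  also have "\<dots> \<le> (?t + C + 1) * ?R" using R by (simp add: algebra_simps)
  also have "\<dots> \<le> (?t + C + 1) * (2 / ln 2 * ln (real N)) powr \<tau>"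
    using k \<tau> C0 by (intro mult_left_mono powr_mono2) auto
  also have "\<dots> = (?t + C + 1) * (2 / ln 2) powr \<tau> * ln (real N) powr \<tau>"
    using N powr_mult[of "2 / ln 2" "ln (real N)" \<tau>] by (simp only: mult.assoc)
  finally show "real N * star_discrepancy (hybrid_point a bs) (1 + length bs) N
      \<le> (?t + C + 1) * (2 / ln 2) powr \<tau> * ln (real N) powr \<tau>" .
qed

theorem theorem4:
  fixes bs :: "'p::prime_card mod_ring poly list"
  assumes monic: "\<forall>b\<in>set bs. lead_coeff b = 1"
    and nonconst: "\<forall>b\<in>set bs. degree b \<ge> 1"
    and coprime: "\<forall>i<length bs. \<forall>j<length bs. i \<noteq> j \<longrightarrow> coprime (bs ! i) (bs ! j)"
  shows "AE a in haar_H. \<forall>\<epsilon>>0. \<exists>c>0. \<forall>N\<ge>2.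
           real N * star_discrepancy (hybrid_point a bs) (1 + length bs) N
             \<le> c * ln (real N) powr (real (length bs) + 1 + \<epsilon>)"
proof -
  have sorted: "sorted_wrt coprime bs" using coprime by (simp add: sorted_wrt_iff_nth_less)
  have bs0: "0 \<notin> set bs" using nonconst by force
  \<comment> \<open>The exceptional null set must not depend on \<epsilon>, so only the countably
    many values \<open>1 / (n + 1)\<close> are used; larger \<epsilon> follow by monotonicity, as
    \<open>2 ^ k \<ge> 1\<close>.\<close>
  have "AE a in haar_H. \<forall>n. \<exists>C. \<forall>k. discr_bound 1 (2 ^ k) bs a
      \<le> C * real (2 ^ k) powr (real (length bs) + 1 + 1 / real (Suc n))"
    by (intro AE_all_countable[THEN iffD2] allI AE_discr_bound bs0) simp
  then show ?thesis
  proof eventually_elim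
    fix a :: "nat \<Rightarrow> 'p mod_ring"
    assume a: "\<forall>n. \<exists>C. \<forall>k. discr_bound 1 (2 ^ k) bs a \<le> C * real (2 ^ k) powr (real (length bs) + 1 + 1 / real (Suc n))"
    show "\<forall>\<epsilon>>0. \<exists>c>0. \<forall>N\<ge>2. real N * star_discrepancy (hybrid_point a bs) (1 + length bs) N
             \<le> c * ln (real N) powr (real (length bs) + 1 + \<epsilon>)"
    proof (intro allI impI)
      fix \<epsilon> :: real assume \<epsilon>: "\<epsilon> > 0"
      then obtain n where n: "1 / real (Suc n) < \<epsilon>" using nat_approx_posE by blast
      from a obtain C where C: "\<And>k. discr_bound 1 (2 ^ k) bs a
          \<le> C * real (2 ^ k) powr (real (length bs) + 1 + 1 / real (Suc n))" by blast
      have C0: "C \<ge> 0" using order.trans[OF discr_bound_nonneg C[of 0]] by simp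
      have "discr_bound 1 (2 ^ k) bs a \<le> C * real (2 ^ k) powr (real (length bs) + 1 + \<epsilon>)" for k
        by (rule order.trans[OF C]) (use n C0 in \<open>intro mult_left_mono powr_mono, auto\<close>)
      then show "\<exists>c>0. \<forall>N\<ge>2. real N * star_discrepancy (hybrid_point a bs) (1 + length bs) N
             \<le> c * ln (real N) powr (real (length bs) + 1 + \<epsilon>)"
        using \<epsilon> by (intro star_discrepancy_growth[OF sorted nonconst]) auto
    qed
  qed
qed

end
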